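(* Let $n\ge 2$ and $l\ge 1$ be integers and let $M(z,\bar z)$ be a non-zero bihomogeneous Hermitian polynomial on $\mathbb C^n$ with signature $(p,q)$ and rank $r=p+q$. If $M(z,\bar z)\|z\|^{2l}$ is a sum of squared norms, then $$p\ge \frac{r_{(n-1)}|_0^{l}}{\binom{n-1+l}{l}}.$$ In particular, when $l=1$, $p\ge \dfrac{r_{(n-1)}|_0^{1}}{n}$.
   Context: Here $\|z\|^2=|z_1|^2+\cdots+|z_n|^2$. A polynomial $M(z,\bar z)\in\mathbb C[z_1,\dots,z_n,\bar z_1,\dots,\bar z_n]$ is Hermitian if it is real-valued, and bihomogeneous of bidegree $(d,d)$ if it is homogeneous of degree $d$ in $z$ and of degree $d$ in $\bar z$; "bihomogeneous" means of bidegree $(d,d)$ for some $d$. Such an $M$ can be written $M(z,\bar z)=Z_d^H\mathcal M Z_d$ with $Z_d$ the vector of all monomials of degree $d$ in $z$ and $\mathcal M$ a Hermitian matrix. The signature $(p,q)$ of $M$ is the pair (number of positive eigenvalues, number of negative eigenvalues) of $\mathcal M$; equivalently $M=|m_1|^2+\cdots+|m_p|^2-|m_{p+1}|^2-\cdots-|m_{p+q}|^2$ with linearly independent holomorphic polynomials $m_i(z)$. The rank of $M$ is $p+q$. "$F(z,\bar z)$ is a sum of squared norms" means $F=|h_1|^2+\cdots+|h_R|^2$ for some holomorphic polynomials $h_i(z)$. Macaulay representation: for positive integers $A$ and $N$ there exist a unique integer $\delta$ with $1\le\delta\le N$ and unique integers $a_N>a_{N-1}>\cdots>a_\delta>0$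 with $a_j\ge j$ for every $j$ such that $A=\binom{a_N}{N}+\cdots+\binom{a_\delta}{\delta}$. For integers $\sigma,\tau$ define $A_{(N)}|_\sigma^\tau=\binom{a_N+\tau}{N+\sigma}+\cdots+\binom{a_\delta+\tau}{\delta+\sigma}$. *)

theory Defs
  imports
    "HOL-Analysis.Analysis"
    "HOL-Library.Poly_Mapping"
    "HOL-Library.Product_Plus"
    "Jordan_Normal_Form.Char_Poly"
begin

text \<open>
  Points of \<open>\<complex>\<^sup>n\<close> are vectors of type \<^typ>\<open>complex ^ 'n\<close> with \<open>n = CARD('n)\<close>.
  A monomial \<open>z\<^sup>\<alpha>\<close> is given by its exponent \<open>\<alpha> :: 'n \<Rightarrow>\<^sub>0 nat\<close>. A polynomial in \<open>z\<close> and
  its conjugate is given by its coefficients, the pair \<open>(\<alpha>, \<beta>)\<close> standing for the product of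
  \<open>z\<^sup>\<alpha>\<close> and the conjugate of \<open>z\<^sup>\<beta>\<close>.
  Component access is written \<^const>\<open>vec_nth\<close> because two libraries compete for its infix symbol.
\<close>

type_synonym 'n holpoly = "('n \<Rightarrow>\<^sub>0 nat) \<Rightarrow>\<^sub>0 complex"
type_synonym 'n bipoly = "(('n \<Rightarrow>\<^sub>0 nat) \<times> ('n \<Rightarrow>\<^sub>0 nat)) \<Rightarrow>\<^sub>0 complex"

definition mdeg :: "('n::finite \<Rightarrow>\<^sub>0 nat) \<Rightarrow> nat" where
  "mdeg \<alpha> = (\<Sum>i\<in>UNIV. Poly_Mapping.lookup \<alpha> i)"

definition mono_val :: "complex ^ 'n \<Rightarrow> ('n::finite \<Rightarrow>\<^sub>0 nat) \<Rightarrow> complex" where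
  "mono_val z \<alpha> = (\<Prod>i\<in>UNIV. vec_nth z i ^ Poly_Mapping.lookup \<alpha> i)"

definition hol_eval :: "'n::finite holpoly \<Rightarrow> complex ^ 'n \<Rightarrow> complex" where
  "hol_eval h z = (\<Sum>\<alpha>\<in>Poly_Mapping.keys h. Poly_Mapping.lookup h \<alpha> * mono_val z \<alpha>)"

definition bi_eval :: "'n::finite bipoly \<Rightarrow> complex ^ 'n \<Rightarrow> complex" where
  "bi_eval M z = (\<Sum>(\<alpha>, \<beta>)\<in>Poly_Mapping.keys M.
      Poly_Mapping.lookup M (\<alpha>, \<beta>) * mono_val z \<alpha> * cnj (mono_val z \<beta>))"

definition hermitian_poly :: "'n::finite bipoly \<Rightarrow> bool" where
  "hermitian_poly M \<longleftrightarrow> (\<forall>z. bi_eval M z \<in> \<real>)"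

definition bihomogeneous :: "nat \<Rightarrow> 'n::finite bipoly \<Rightarrow> bool" where
  "bihomogeneous d M \<longleftrightarrow> (\<forall>(\<alpha>, \<beta>)\<in>Poly_Mapping.keys M. mdeg \<alpha> = d \<and> mdeg \<beta> = d)"

definition sum_of_squared_norms :: "(complex ^ 'n::finite \<Rightarrow> complex) \<Rightarrow> bool" where
  "sum_of_squared_norms F \<longleftrightarrow>
    (\<exists>(R::nat) (h :: nat \<Rightarrow> 'n holpoly).
       \<forall>z. F z = complex_of_real (\<Sum>i<R. (cmod (hol_eval (h i) z))\<^sup>2))"

text \<open>
  The vector \<open>Z\<^sub>d\<close> of all monomials of degree \<open>d\<close>, in an arbitrary but fixed order;
  reordering it conjugates the coefficient matrix by a permutation matrix.
\<close>

definition monomials :: "nat \<Rightarrow> ('n::finite \<Rightarrow>\<^sub>0 nat) list" where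
  "monomials d = (SOME Z. distinct Z \<and> set Z = {\<alpha>. mdeg \<alpha> = d})"

text \<open>
  In \<open>Z\<^sub>d\<^sup>H \<M> Z\<^sub>d\<close> the row index belongs to the conjugated monomial; see \<open>coeff_matrix_repr\<close> below.
\<close>

definition coeff_matrix :: "nat \<Rightarrow> 'n::finite bipoly \<Rightarrow> complex mat" where
  "coeff_matrix d M =
    (let Z = monomials d; m = length Z in mat m m (\<lambda>(i, j). Poly_Mapping.lookup M (Z ! j, Z ! i)))"

text \<open>
  Eigenvalues are counted with multiplicity, as roots of the characteristic polynomial.
\<close>

definition num_pos_eigenvalues :: "complex mat \<Rightarrow> nat" where
  "num_pos_eigenvalues A = size {# x \<in># proots (char_poly A). x \<in> \<real> \<and> Re x > 0 #}"

definition num_neg_eigenvalues :: "complex mat \<Rightarrow> nat" where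
  "num_neg_eigenvalues A = size {# x \<in># proots (char_poly A). x \<in> \<real> \<and> Re x < 0 #}"

definition poly_signature :: "nat \<Rightarrow> 'n::finite bipoly \<Rightarrow> nat \<times> nat" where
  "poly_signature d M =
    (num_pos_eigenvalues (coeff_matrix d M), num_neg_eigenvalues (coeff_matrix d M))"

text \<open>
  The Macaulay representation of \<open>A\<close>. Only the values of \<open>a\<close> on \<open>{\<delta>..N}\<close> matter, and only
  these are unique.
\<close>

definition macaulay_rep :: "nat \<Rightarrow> nat \<Rightarrow> nat \<Rightarrow> (nat \<Rightarrow> nat) \<Rightarrow> bool" where
  "macaulay_rep A N \<delta> a \<longleftrightarrow>
     1 \<le> \<delta> \<and> \<delta> \<le> N \<and> strict_mono_on {\<delta>..N} a \<and> a \<delta> > 0 \<and> (\<forall>j\<in>{\<delta>..N}. a j \<ge> j) \<and>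
     A = (\<Sum>j=\<delta>..N. a j choose j)"

text \<open>
  Binomial coefficients with integer entries, taken to be \<open>0\<close> unless \<open>0 \<le> k \<le> m\<close>.
\<close>

definition int_choose :: "int \<Rightarrow> int \<Rightarrow> nat" where
  "int_choose m k = (if 0 \<le> k \<and> k \<le> m then nat m choose nat k else 0)"

definition macaulay_shift :: "nat \<Rightarrow> nat \<Rightarrow> int \<Rightarrow> int \<Rightarrow> nat" where
  "macaulay_shift A N \<sigma> \<tau> =
     (THE v. \<exists>\<delta> a. macaulay_rep A N \<delta> a \<and>
        v = (\<Sum>j=\<delta>..N. int_choose (int (a j) + \<tau>) (int j + \<sigma>)))"

lemma finite_mdeg: "finite {\<alpha> :: 'n::finite \<Rightarrow>\<^sub>0 nat. mdeg \<alpha> = d}"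
proof -
  have "Poly_Mapping.lookup ` {\<alpha> :: 'n \<Rightarrow>\<^sub>0 nat. mdeg \<alpha> = d} \<subseteq> (UNIV :: 'n set) \<rightarrow>\<^sub>E {..d}"
    by (auto simp: mdeg_def intro: member_le_sum)
  then have "finite (Poly_Mapping.lookup ` {\<alpha> :: 'n \<Rightarrow>\<^sub>0 nat. mdeg \<alpha> = d})"
    by (rule finite_subset) (auto intro: finite_PiE)
  then show ?thesis
    by (rule finite_imageD) (auto simp: inj_on_def poly_mapping.lookup_inject)
qed

lemma monomials: "distinct (monomials d :: ('n::finite \<Rightarrow>\<^sub>0 nat) list)"
  "set (monomials d :: ('n \<Rightarrow>\<^sub>0 nat) list) = {\<alpha>. mdeg \<alpha> = d}"
proof -
  have "\<exists>Z. distinct Z \<and> set Z = {\<alpha> :: 'n \<Rightarrow>\<^sub>0 nat. mdeg \<alpha> = d}"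
    using finite_distinct_list[OF finite_mdeg] by blast
  from someI_ex[OF this] show "distinct (monomials d :: ('n \<Rightarrow>\<^sub>0 nat) list)"
    "set (monomials d :: ('n \<Rightarrow>\<^sub>0 nat) list) = {\<alpha>. mdeg \<alpha> = d}"
    by (simp_all add: monomials_def)
qed

lemma coeff_matrix_repr:
  fixes M :: "'n::finite bipoly" and z :: "complex ^ 'n" and d :: nat
  defines "Z \<equiv> monomials d :: ('n \<Rightarrow>\<^sub>0 nat) list"
  assumes "bihomogeneous d M"
  shows "bi_eval M z =
    (\<Sum>i<length Z. \<Sum>j<length Z.
       cnj (mono_val z (Z ! i)) * (coeff_matrix d M $$ (i, j)) * mono_val z (Z ! j))"
proof -
  let ?D = "{\<alpha> :: 'n \<Rightarrow>\<^sub>0 nat. mdeg \<alpha> = d}"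
  let ?g = "\<lambda>\<alpha> \<beta>. cnj (mono_val z \<alpha>) * Poly_Mapping.lookup M (\<beta>, \<alpha>) * mono_val z \<beta>"
  have bij: "bij_betw ((!) Z) {..<length Z} ?D"
    using bij_betw_nth[OF monomials(1) refl refl, of d] monomials(2) unfolding Z_def by metis
  have "bi_eval M z = (\<Sum>(\<beta>, \<alpha>)\<in>?D \<times> ?D. ?g \<alpha> \<beta>)"
    unfolding bi_eval_def using assms(2)
    by (intro sum.mono_neutral_cong_left)
      (auto simp: finite_mdeg bihomogeneous_def in_keys_iff)
  also have "\<dots> = (\<Sum>\<alpha>\<in>?D. \<Sum>\<beta>\<in>?D. ?g \<alpha> \<beta>)"
    by (subst sum.cartesian_product[symmetric]) (rule sum.swap)
  also have "\<dots> = (\<Sum>i<length Z. \<Sum>j<length Z. ?g (Z ! i) (Z ! j))"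
    by (simp add: sum.reindex_bij_betw[OF bij, symmetric])
  finally show ?thesis
    by (simp add: coeff_matrix_def Let_def Z_def)
qed

end

theory Submission
  imports Defs "HOL-Library.Function_Algebras" "Jordan_Normal_Form.Schur_Decomposition"
begin

text \<open>
  Diagonalizing the coefficient matrix gives \<open>M = \<Sum> \<mu>\<^sub>k |u\<^sub>k|\<^sup>2\<close> with orthonormal \<open>u\<^sub>k\<close>. If
  \<open>M \<parallel>z\<parallel>\<^sup>2\<^sup>l\<close> is a sum of squared norms, comparing coefficient matrices shows that the products
  \<open>z\<^sup>\<gamma> u\<^sub>k\<close> with \<open>|\<gamma>| = l\<close> and \<open>\<mu>\<^sub>k < 0\<close> lie in the span of those with \<open>\<mu>\<^sub>k > 0\<close>. So the degree \<open>l\<close>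
  multiples of the \<open>r\<close>-dimensional space spanned by all \<open>u\<^sub>k\<close> with \<open>\<mu>\<^sub>k \<noteq> 0\<close> span a space of dimension
  at most \<open>p\<close> times the number of monomials of degree \<open>l\<close>. Macaulay's growth bound says that this
  dimension is at least \<open>r\<^sub>(\<^sub>n\<^sub>-\<^sub>1\<^sub>)|\<^sub>0\<^sup>l\<close>. Passing to leading monomials, and dropping one exponent, the
  bound for \<open>l = 1\<close> concerns the sumset of a finite set in \<open>\<nat>\<^sup>n\<^sup>-\<^sup>1\<close> with the standard simplex; there it
  follows by cutting off the lowest slice.
\<close>

section \<open>Growth of Macaulay representations\<close>

text \<open>No extremal set such as a lexicographic segment is constructed: \<open>growth\<close> is
  pure arithmetic, and the combinatorics is reduced to inequalities between numbers. The obstacle is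
  the part of the sumset above the lowest slice. It has two natural lower bounds, a translate of the
  whole set and the sumset of the remaining slices, and neither is large enough for every slice
  size. That one of the two always suffices is \<open>growth_peel\<close>; its delicate cases rest
  on the exchange inequality \<open>growth_exchange\<close>. The step from \<open>l = 1\<close> to
  general \<open>l\<close> is plain iteration, because raising all entries of a Macaulay
  representation by one gives again a Macaulay representation. On the analytic side, the span
  argument tests against arbitrary functionals and not only against evaluation at points, which is
  why values have to be converted into coefficients.\<close>

text \<open>\<open>growth N r\<close> is \<open>r\<^sub>(\<^sub>N\<^sub>)|\<^sub>0\<^sup>1\<close>, computed greedily: the leading binomial coefficient of the
  Macaulay representation is the largest one not exceeding \<open>r\<close>. The value for \<open>N = 0\<close>, where there is no
  Macaulay representation, is the number of points of a set with at most one point.\<close>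

primrec growth :: "nat \<Rightarrow> nat \<Rightarrow> nat" where
  "growth 0 r = min r 1"
| "growth (Suc N) r = (if r = 0 then 0 else
     let b = (GREATEST b. b choose Suc N \<le> r) in
       (Suc b choose Suc N) + growth N (r - (b choose Suc N)))"

lemma growth_0 [simp]: "growth N 0 = 0"
  by (cases N) auto

section \<open>Binomial blocks and the greedy recursion\<close>

lemma choose_mono_left: "m \<le> n \<Longrightarrow> m choose k \<le> n choose k"
proof (rule lift_Suc_mono_le[of "\<lambda>n. n choose k"])
  show "n choose k \<le> Suc n choose k" for n by (cases k) auto
qed
text \<open>Bounds the indices \<open>b\<close> with \<open>b choose Suc N \<le> r\<close>, so that
  a greatest one exists.\<close>

lemma le_choose: "b \<ge> Suc N \<Longrightarrow> b - N \<le> b choose Suc N"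
proof (induction b)
  case (Suc b)
  show ?case
  proof (cases "b = N")
    case False
    with Suc have "b - N \<le> b choose Suc N" "b choose N > 0" by auto
    then show ?thesis using binomial_Suc_Suc[of b N] by linarith
  qed auto
qed auto

lemma choose_block_exists:
  assumes "r > 0"
  obtains b where "b \<ge> Suc N" "b choose Suc N \<le> r" "r < Suc b choose Suc N"
proof -
  let ?P = "\<lambda>b. b choose Suc N \<le> r"
  have bound: "b \<le> r + Suc N" if "?P b" for b
    using le_choose[of N b] that by (cases "b \<ge> Suc N") auto
  have 1: "?P (Suc N)" using assms by simp
  have "?P (Greatest ?P)" by (rule GreatestI_nat[of ?P, OF 1]) (use bound in auto)
  moreover have "Suc N \<le> Greatest ?P" by (rule Greatest_le_nat[of ?P, OF 1]) (use bound in auto)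
  moreover have "\<not> ?P (Suc (Greatest ?P))"
    using Greatest_le_nat[of ?P "Suc (Greatest ?P)" "r + Suc N"] bound by auto
  ultimately show ?thesis using that by auto
qed

text \<open>By Pascal's rule \<open>t < b choose N\<close> keeps the sum below
  \<open>Suc b choose Suc N\<close>, so \<open>b\<close> is the greedy choice.\<close>

lemma growth_block_less:
  assumes "b \<ge> Suc N" "t < b choose N"
  shows "growth (Suc N) ((b choose Suc N) + t) = (Suc b choose Suc N) + growth N t"
proof -
  have "(GREATEST b'. b' choose Suc N \<le> (b choose Suc N) + t) = b"
  proof (rule Greatest_equality)
    fix y assume y: "y choose Suc N \<le> (b choose Suc N) + t"
    show "y \<le> b"
    proof (rule ccontr)
      assume "\<not> y \<le> b"
      then have "Suc b choose Suc N \<le> y choose Suc N" by (intro choose_mono_left) auto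
      then show False using y assms by simp
    qed
  qed simp
  moreover have "b choose Suc N > 0" using assms by (simp add: zero_less_binomial)
  ultimately show ?thesis by (auto simp del: binomial_Suc_Suc simp: Let_def)
qed

declare growth.simps(2) [simp del]

lemma growth_choose:
  assumes "b \<ge> N" shows "growth N (b choose N) = Suc b choose N"
proof (cases N)
  case (Suc N')
  have "b choose N' > 0" using assms Suc by (simp add: zero_less_binomial)
  then show ?thesis using growth_block_less[of N' b 0] assms Suc by simp
qed simp

text \<open>At the boundary \<open>t = b choose N\<close> the greedy block is already
  \<open>Suc b\<close>, and Pascal's rule makes both evaluations agree. With the closed range a
  block can be filled exactly without leaving the formula.\<close>

lemma growth_block:
  assumes "b \<ge> Suc N" "t \<le> b choose N"
  shows "growth (Suc N) ((b choose Suc N) + t) = (Suc b choose Suc N) + growth N t"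
proof (cases "t = b choose N")
  case True
  have "growth (Suc N) (Suc b choose Suc N) = (Suc (Suc b) choose Suc N)"
    using assms by (intro growth_choose) auto
  then show ?thesis using True assms growth_choose[of N b]
    by (simp add: add.commute)
qed (use assms growth_block_less in auto)

lemma growth_1: "growth N 1 = Suc N"
  using growth_choose[of N N] by (simp add: binomial_Suc_n)

text \<open>\<open>growth 0\<close> is capped at 1, so for \<open>N = 0\<close> the step is strict
  only at \<open>r = 0\<close>. The induction meets just that case: a remainder with
  \<open>Suc t \<le> b choose 0\<close> is \<open>0\<close>.\<close>

lemma growth_Suc: 
  assumes "N > 0 \<or> r = 0" shows "growth N r + 1 \<le> growth N (Suc r)"
  using assms
proof (induction N arbitrary: r)
  case (Suc N)
  show ?case
  proof (cases "r = 0")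
    case True
    then show ?thesis using growth_1[of "Suc N"] by auto
  next
    case False
    then obtain b where b: "b \<ge> Suc N" "b choose Suc N \<le> r" "r < Suc b choose Suc N"
      using choose_block_exists[of r N] by auto
    define t where "t = r - (b choose Suc N)"
    have t: "r = (b choose Suc N) + t" "Suc t \<le> b choose N" using b by (auto simp: t_def)
    have "growth N t + 1 \<le> growth N (Suc t)" using t b by (intro Suc.IH) (cases N, auto)
    then show ?thesis
      using growth_block[OF b(1), of t] growth_block[OF b(1), of "Suc t"] t by simp
  qed
qed auto

lemma growth_mono: "r \<le> s \<Longrightarrow> growth N r \<le> growth N s"
proof (cases "N = 0")
  case False
  then have "growth N r \<le> growth N (Suc r)" for r using growth_Suc[of N r] by auto
  then show "r \<le> s \<Longrightarrow> growth N r \<le> growth N s" by (rule lift_Suc_mono_le)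
qed auto

text \<open>The excess \<open>growth N r - r\<close> cannot drop, since each step of
  \<open>r\<close> adds at least one to \<open>growth\<close>; written without subtraction because
  \<open>nat\<close> truncates.\<close>

lemma growth_excess_mono: "N > 0 \<Longrightarrow> r \<le> s \<Longrightarrow> growth N r + s \<le> growth N s + r"
proof (induction s)
  case (Suc s) then show ?case using growth_Suc[of N s] by (cases "r = Suc s") auto
qed auto

section \<open>Exchange and slicing inequalities\<close>

text \<open>Splitting along the block of \<open>y - 1\<close> rather than \<open>y\<close> keeps the
  remainder \<open>t\<close> positive, so moving it away shrinks \<open>y\<close>; a binomial
  coefficient \<open>y > 1\<close> gives up a whole block \<open>b choose N\<close>. The last clause
  lets a part \<open>u\<close> of \<open>t\<close> stay behind.\<close>

lemma growth_last_block:
  assumes "y > 0"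
  obtains b t where "y = (b choose Suc N) + t" "0 < t" "t \<le> b choose N"
    "growth (Suc N) (b choose Suc N) + growth N t \<le> growth (Suc N) y"
    "\<And>u. u < t \<Longrightarrow> growth (Suc N) ((b choose Suc N) + u) = growth (Suc N) (b choose Suc N) + growth N u"
proof (cases "y = 1")
  case True
  \<comment> \<open>With \<open>b = N\<close> the block \<open>b choose Suc N\<close> is empty and
    all of \<open>y\<close> is remainder; the growth inequality is strict here.\<close>
  show ?thesis
    by (rule that[of N 1]) (use True growth_1[of N] growth_1[of "Suc N"] in \<open>auto simp: binomial_eq_0\<close>)
next
  case False
  then obtain b where b: "b \<ge> Suc N" "b choose Suc N \<le> y - 1" "y - 1 < Suc b choose Suc N"
    using choose_block_exists[of "y - 1" N] assms by (metis One_nat_def Suc_lessI zero_less_diff)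
  define t where "t = y - (b choose Suc N)"
  have t: "y = (b choose Suc N) + t" "0 < t" "t \<le> b choose N" using b assms by (auto simp: t_def)
  show ?thesis
    by (rule that[of b t]) (use t growth_block[OF b(1)] growth_choose[OF b(1)] in auto)
qed

text \<open>Moving mass from \<open>y\<close> to \<open>x\<close>, up to the capacity \<open>c choose N\<close>, does not increase the total growth.
  The last Macaulay block of \<open>y\<close> is moved onto the last block of \<open>x\<close>, which is an instance of the
  statement for \<open>N - 1\<close>; this is repeated until \<open>y\<close> is used up or \<open>x\<close> is full.\<close>

lemma growth_exchange:
  assumes "c \<ge> N" "x \<le> c choose N" "y \<le> c choose N"
  shows "(x + y \<le> c choose N \<longrightarrow> growth N (x + y) \<le> growth N x + growth N y) \<and>
    (c choose N \<le> x + y \<longrightarrow>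
      growth N (c choose N) + growth N (x + y - (c choose N)) \<le> growth N x + growth N y)"
  using assms
proof (induction N arbitrary: c x y)
  case 0
  then show ?case by auto
next
  case (Suc N)
  let ?g = "growth (Suc N)" and ?C = "c choose Suc N"
  let ?P = "\<lambda>x y. (x + y \<le> ?C \<longrightarrow> ?g (x + y) \<le> ?g x + ?g y) \<and>
    (?C \<le> x + y \<longrightarrow> ?g ?C + ?g (x + y - ?C) \<le> ?g x + ?g y)"
  \<comment> \<open>The claim is symmetric, so the smaller number may be the donor; this forces
    \<open>b \<le> a\<close> below, hence \<open>t \<le> a choose N\<close>, as the outer induction
    hypothesis requires.\<close>
  have main: "?P x y" if "y \<le> x" "x \<le> ?C" for x y
    using that
  proof (induction y arbitrary: x rule: less_induct)
    case (less y)
    consider "y = 0" | "x = ?C" | "0 < y" "x < ?C" using less.prems by linarith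
    then show ?case
    proof cases
      case 1
      then show ?thesis using less.prems by (cases "x = ?C") auto
    next
      case 3
      then have "0 < x" using less.prems by auto
      then obtain a where a: "a \<ge> Suc N" "a choose Suc N \<le> x" "x < Suc a choose Suc N"
        using choose_block_exists[of x N] by auto
      define x' where "x' = x - (a choose Suc N)"
      have x: "x = (a choose Suc N) + x'" "x' < a choose N" using a by (auto simp: x'_def)
      obtain b t where b: "y = (b choose Suc N) + t" "0 < t" "t \<le> b choose N"
        "?g (b choose Suc N) + growth N t \<le> ?g y"
        "\<And>u. u < t \<Longrightarrow> ?g ((b choose Suc N) + u) = ?g (b choose Suc N) + growth N u"
        using growth_last_block[OF 3(1), of N] by metis
      have "a < c" using a 3 choose_mono_left[of c a "Suc N"] by (metis leD leI le_trans)
      have "b \<le> a"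
      proof (rule ccontr)
        assume "\<not> b \<le> a"
        then have "Suc a choose Suc N \<le> b choose Suc N" by (intro choose_mono_left) auto
        then show False using a b less.prems by linarith
      qed
      then have "t \<le> a choose N" using b choose_mono_left[of b a N] by linarith
      have ca: "Suc a choose Suc N \<le> ?C" using \<open>a < c\<close> by (intro choose_mono_left) auto
      have gx: "?g x = (Suc a choose Suc N) + growth N x'"
        using growth_block[OF a(1), of x'] x by auto
      note IH = Suc.IH[of a x' t]
      let ?P' = "\<lambda>k. (x + y \<le> ?C \<longrightarrow> ?g (x + y) \<le> k) \<and>
        (?C \<le> x + y \<longrightarrow> ?g ?C + ?g (x + y - ?C) \<le> k)"
      show ?thesis
      proof (cases "x' + t \<le> a choose N")
        case True
        have "growth N (x' + t) \<le> growth N x' + growth N t"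
          using IH True a x \<open>t \<le> a choose N\<close> by auto
        moreover have "?g (x + t) = (Suc a choose Suc N) + growth N (x' + t)"
          using growth_block[OF a(1) True] x by (simp add: add.assoc)
        ultimately have le: "?g (x + t) + ?g (y - t) \<le> ?g x + ?g y"
          using gx b by auto
        have "x + t \<le> Suc a choose Suc N" using x True by simp
        then have "?P (x + t) (y - t)"
          using less.prems b ca by (intro less.IH) auto
        moreover have "x + t + (y - t) = x + y" using b by auto
        ultimately have "?P' (?g (x + t) + ?g (y - t))" by (simp only:)
        then show ?thesis using le by (blast intro: order_trans)
      next
        case False
        \<comment> \<open>The transfer overfills the block of \<open>x\<close>: \<open>t\<close>
          completes it to \<open>Suc a choose Suc N\<close>, and the overflow \<open>u\<close>
          begins the next block.\<close>
        define u where "u = x' + t - (a choose N)"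
        have u: "x' + t = (a choose N) + u" "u < t" using False x by (auto simp: u_def)
        have le: "(Suc a choose N) + growth N u \<le> growth N x' + growth N t"
          using IH False a x \<open>t \<le> a choose N\<close> growth_choose[of N a] by (auto simp: u_def)
        have xt: "x + t = (Suc a choose Suc N) + u" using x u by simp
        show ?thesis
        proof (cases "Suc a = c")
          case True
          \<comment> \<open>No next block is available, since \<open>x\<close> has reached the
            capacity; the overflow goes back to \<open>y\<close>, which is left with
            \<open>w\<close>.\<close>
          define w where "w = (b choose Suc N) + u"
          have "x + y = ?C + w" using xt b True by (simp add: w_def)
          moreover have "?g ?C = (Suc a choose Suc N) + (Suc a choose N)" 
            using growth_choose[of "Suc N" c] True a by simp
          ultimately show ?thesis using b(4) b(5)[OF u(2), folded w_def] le gx by auto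
        next
          case F: False
          have uu: "u \<le> Suc a choose N"
            using u b \<open>t \<le> a choose N\<close> choose_mono_left[of a "Suc a" N] by auto
          have "?g (x + t) = (Suc (Suc a) choose Suc N) + growth N u"
            unfolding xt using a uu by (intro growth_block) auto
          then have le2: "?g (x + t) + ?g (y - t) \<le> ?g x + ?g y"
            using gx b le by auto
          have "x + t \<le> Suc (Suc a) choose Suc N" using xt uu by simp
          also have "\<dots> \<le> ?C" using \<open>a < c\<close> F by (intro choose_mono_left) auto
          finally have "?P (x + t) (y - t)"
            using less.prems b ca by (intro less.IH) auto
          moreover have "x + t + (y - t) = x + y" using b by auto
          ultimately have "?P' (?g (x + t) + ?g (y - t))" by (simp only:)
          then show ?thesis using le2 by (blast intro: order_trans)
        qed
      qed
    qed auto
  qed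
  show ?case
  proof (cases "y \<le> x")
    case True then show ?thesis using main[of y x] Suc.prems by blast
  next
    case False then show ?thesis using main[of x y] Suc.prems by (simp add: add.commute)
  qed
qed

text \<open>Numerical form of the slicing step: \<open>s\<close> is the size of the lowest slice of a set of size \<open>r\<close>.\<close>

lemma growth_peel:
  assumes "s \<le> r"
  shows "growth (Suc N) r \<le> growth N s + r \<or>
    growth (Suc N) r \<le> growth N s + growth (Suc N) (r - s)"
  using assms
proof (induction N arbitrary: r s)
  case 0
  show ?case
  proof (cases "s = 0")
    case False
    then have "r > 0" using 0 by auto
    then have "growth (Suc 0) r = Suc r" using growth_choose[of 1 r] by simp
    then show ?thesis using False by simp
  qed simp
next
  case (Suc N)
  let ?F = "growth (Suc N)" and ?G = "growth (Suc (Suc N))"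
  consider "s = 0" | "r = 1" "s = 1" | "r > 1" "s > 0" using Suc.prems by linarith
  then show ?case
  proof cases
    case 2
    then show ?thesis using growth_1[of "Suc N"] growth_1[of "Suc (Suc N)"] by auto
  next
    case 3
    then obtain b where b: "b \<ge> Suc (Suc N)" "b choose Suc (Suc N) \<le> r" "r < Suc b choose Suc (Suc N)"
      using choose_block_exists[of r "Suc N"] by auto
    define r' where "r' = r - (b choose Suc (Suc N))"
    have r: "r = (b choose Suc (Suc N)) + r'" "r' < b choose Suc N" using b by (auto simp: r'_def)
    have Gr: "?G r = (Suc b choose Suc (Suc N)) + ?F r'"
      using growth_block[OF b(1), of r'] r by auto
    obtain b1 where b1: "b = Suc b1" using b by (cases b) auto
    \<comment> \<open>By Pascal's rule \<open>b1 choose Suc N\<close> is the amount whose removal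
      lowers the leading block of \<open>r\<close> from \<open>b\<close> to \<open>b1\<close>. Case
      1 gives the first disjunct (translate of the whole set), cases 2 and 3 the second (remaining
      slices); between \<open>b1 choose Suc N\<close> and \<open>b choose Suc N\<close> either may
      occur.\<close>
    consider "b choose Suc N \<le> s" | "s \<le> r'" | "r' < s" "s \<le> b1 choose Suc N"
      | "s > b1 choose Suc N" "s < b choose Suc N" using b by linarith
    then show ?thesis
    proof cases
      case 1
      have "?F (b choose Suc N) = Suc b choose Suc N" using b by (intro growth_choose) auto
      then have "Suc b choose Suc N \<le> ?F s" "?F r' + (b choose Suc N) \<le> (Suc b choose Suc N) + r'"
        using growth_mono[OF 1, of "Suc N"] growth_excess_mono[of "Suc N" r' "b choose Suc N"] r by auto
      then show ?thesis using Gr r by simp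
    next
      case 2
      have "?F (r' - s + s) \<le> ?F (r' - s) + ?F s"
        using growth_exchange[of "Suc N" b "r' - s" s] b r 2 by auto
      moreover have "?G (r - s) = (Suc b choose Suc (Suc N)) + ?F (r' - s)"
      proof -
        have "r - s = (b choose Suc (Suc N)) + (r' - s)" using r 2 by auto
        then show ?thesis using growth_block[OF b(1), of "r' - s"] r by simp
      qed
      ultimately show ?thesis using Gr 2 by auto
    next
      case A: 3
      have "b1 \<ge> Suc (Suc N)"
      proof (rule ccontr)
        assume "\<not> ?thesis"
        then have "b1 = Suc N" using b b1 by auto
        then have "s = 1" "r' = 0" "b = Suc (Suc N)" using A b1 3 by auto
        then show False using r 3 by simp
      qed
      \<comment> \<open>\<open>R\<close> is what \<open>r - s\<close> has beyond the block of
        \<open>b1\<close>; the exchange pours \<open>R\<close> and \<open>s\<close> together,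
        filling the capacity \<open>b1 choose Suc N\<close> and leaving \<open>r'\<close>.\<close>
      define R where "R = (b1 choose Suc N) + r' - s"
      have R: "R + s = (b1 choose Suc N) + r'" "R \<le> b1 choose Suc N" using A by (auto simp: R_def)
      have "?F (b1 choose Suc N) + ?F r' \<le> ?F R + ?F s"
        using growth_exchange[of "Suc N" b1 R s] A R \<open>b1 \<ge> _\<close> by auto
      moreover have "r - s = (b1 choose Suc (Suc N)) + R" using r R b1 A by auto
      then have "?G (r - s) = (b choose Suc (Suc N)) + ?F R"
        using growth_block[OF \<open>b1 \<ge> _\<close> R(2)] b1 by simp
      moreover have "?F (b1 choose Suc N) = b choose Suc N"
        using growth_choose[of "Suc N" b1] \<open>b1 \<ge> _\<close> b1 by auto
      ultimately show ?thesis using Gr by simp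
    next
      case 4
      \<comment> \<open>Both numbers lose their leading block, \<open>b choose Suc (Suc N)\<close>
        in \<open>r\<close> and \<open>b1 choose Suc N\<close> in \<open>s\<close>; the induction
        hypothesis, one dimension lower, compares the remainders \<open>r'\<close> and
        \<open>s'\<close>.\<close>
      define s' where "s' = s - (b1 choose Suc N)"
      have s: "s = (b1 choose Suc N) + s'" "0 < s'" "s' < b1 choose N" using 4 b1 by (auto simp: s'_def)
      have Fs: "?F s = (b choose Suc N) + growth N s'"
        using growth_block[of N b1 s'] s b b1 by auto
      show ?thesis
      proof (cases "s' \<le> r'")
        case False
        then have "?F r' + s' \<le> ?F s' + r'" by (intro growth_excess_mono) auto
        \<comment> \<open>For equal arguments the second disjunct of the hypothesis implies the
          first, because \<open>growth\<close> of \<open>0\<close> is \<open>0\<close>.\<close>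
        moreover have "?F s' \<le> growth N s' + s'" using Suc.IH[of s' s'] by auto
        ultimately show ?thesis using Gr Fs r by simp
      next
        case True
        from Suc.IH[OF this] show ?thesis
        proof
          assume "?F r' \<le> growth N s' + r'"
          then show ?thesis using Gr Fs r by simp
        next
          assume *: "?F r' \<le> growth N s' + ?F (r' - s')"
          have R: "r - s = (b1 choose Suc (Suc N)) + (r' - s')" "r' - s' \<le> b1 choose Suc N" if "r - s \<le> b choose Suc (Suc N)"
            using r s True b1 that by auto
          show ?thesis
          proof (cases "s \<le> r'")
            case T: True
            have "?F (r' - s + s) \<le> ?F (r' - s) + ?F s"
              using growth_exchange[of "Suc N" b "r' - s" s] b r T 4 by auto
            moreover have "r - s = (b choose Suc (Suc N)) + (r' - s)" using r T by auto
            then have "?G (r - s) = (Suc b choose Suc (Suc N)) + ?F (r' - s)"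
              using growth_block[OF b(1), of "r' - s"] r by simp
            ultimately show ?thesis using Gr T by auto
          next
            case F: False
            then have rs: "r - s < b choose Suc (Suc N)"
              using r b zero_less_binomial[of "Suc (Suc N)" b] by linarith
            show ?thesis
            proof (cases "b1 \<ge> Suc (Suc N)")
              case True
              have "?G (r - s) = (b choose Suc (Suc N)) + ?F (r' - s')"
                using growth_block[OF True, of "r' - s'"] R rs b1 by auto
              then show ?thesis using Gr Fs * by simp
            next
              case False
              \<comment> \<open>Degenerate case: the leading block of \<open>r\<close> is 1, so the
                slice is the whole set.\<close>
              then have "b = Suc (Suc N)" using b b1 by auto
              then have "r - s = 0" using rs by simp
              then have "r' = s'" using R rs \<open>s' \<le> r'\<close> by auto
              then show ?thesis using Gr Fs r * by simp
            qed
          qed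
        qed
      qed
    qed
  qed simp
qed

section \<open>Growth and Macaulay representations\<close>

text \<open>Pascal's rule and \<open>a N < a (Suc N)\<close> bound the tail by
  \<open>a (Suc N) choose N\<close>; hence the top term of any Macaulay representation is the greedy
  block.\<close>

lemma macaulay_rep_less:
  "macaulay_rep A N \<delta> a \<Longrightarrow> A < Suc (a N) choose N"
proof (induction N arbitrary: A)
  case (Suc N)
  note rep = Suc.prems[unfolded macaulay_rep_def]
  show ?case
  proof (cases "\<delta> = Suc N")
    case True
    then show ?thesis using rep by (auto simp: zero_less_binomial)
  next
    case False
    then have "macaulay_rep (\<Sum>j=\<delta>..N. a j choose j) N \<delta> a"
      using rep by (auto simp: macaulay_rep_def strict_mono_on_def)
    from Suc.IH[OF this] have "(\<Sum>j=\<delta>..N. a j choose j) < Suc (a N) choose N" .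
    also have "\<dots> \<le> a (Suc N) choose N"
      using rep False by (intro choose_mono_left) (auto simp: strict_mono_on_def Suc_le_eq)
    finally show ?thesis using rep by (simp add: sum.cl_ivl_Suc)
  qed
qed (auto simp: macaulay_rep_def)

lemma growth_macaulay_rep:
  "macaulay_rep A N \<delta> a \<Longrightarrow> growth N A = (\<Sum>j=\<delta>..N. Suc (a j) choose j)"
proof (induction N arbitrary: A)
  case (Suc N)
  note rep = Suc.prems[unfolded macaulay_rep_def]
  show ?case
  proof (cases "\<delta> = Suc N")
    case True
    then show ?thesis using rep growth_choose[of "Suc N" "a (Suc N)"] by auto
  next
    case False
    then have rep': "macaulay_rep (\<Sum>j=\<delta>..N. a j choose j) N \<delta> a"
      using rep by (auto simp: macaulay_rep_def strict_mono_on_def)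
    note macaulay_rep_less[OF rep']
    also have "Suc (a N) choose N \<le> a (Suc N) choose N"
      using rep False by (intro choose_mono_left) (auto simp: strict_mono_on_def Suc_le_eq)
    finally show ?thesis
      using growth_block[of N "a (Suc N)" "\<Sum>j=\<delta>..N. a j choose j"] Suc.IH[OF rep'] rep
      by (simp add: sum.cl_ivl_Suc add.commute)
  qed
qed (auto simp: macaulay_rep_def)

text \<open>Raising every \<open>a j\<close> by one turns a representation of \<open>A\<close> into
  one of \<open>growth N A\<close>, so the one-step formula applies again; the two claims are
  carried through the induction together.\<close>

lemma iterated_growth_macaulay_rep:
  assumes "macaulay_rep A N \<delta> a"
  shows "(growth N ^^ l) A = (\<Sum>j=\<delta>..N. a j + l choose j)"
    and "macaulay_rep ((growth N ^^ l) A) N \<delta> (\<lambda>j. a j + l)"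
proof (induction l)
  case 0
  {
    case 1 then show ?case using assms by (simp add: macaulay_rep_def)
  next
    case 2 then show ?case using assms by simp
  }
next
  case (Suc l)
  {
    case 1 then show ?case using growth_macaulay_rep[OF Suc(2)] by simp
  next
    case 2
    then show ?case using growth_macaulay_rep[OF Suc(2)] assms
      by (auto simp: macaulay_rep_def strict_mono_on_def)
  }
qed

text \<open>The bound \<open>a N < c\<close> strengthens the induction: used for the remainder with
  \<open>c = b\<close>, it keeps the top entry of the tail below \<open>b\<close>, so that
  \<open>a\<close> stays strictly increasing.\<close>

lemma macaulay_rep_exists:
  assumes "A > 0" "N > 0" "A < c choose N" 
  shows "\<exists>\<delta> a. macaulay_rep A N \<delta> a \<and> a N < c"
  using assms
proof (induction N arbitrary: A c)
  case (Suc N)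
  obtain b where b: "b \<ge> Suc N" "b choose Suc N \<le> A" "A < Suc b choose Suc N"
    using choose_block_exists[OF Suc.prems(1), of N] .
  have "b < c"
  proof (rule ccontr)
    assume "\<not> b < c"
    then have "c choose Suc N \<le> b choose Suc N" by (intro choose_mono_left) auto
    then show False using b Suc.prems by auto
  qed
  define r where "r = A - (b choose Suc N)"
  show ?case
  proof (cases "r = 0")
    case True
    then have "macaulay_rep A (Suc N) (Suc N) (\<lambda>_. b)"
      using b by (auto simp: macaulay_rep_def strict_mono_on_def r_def)
    then show ?thesis using \<open>b < c\<close> by blast
  next
    case False
    have r: "A = (b choose Suc N) + r" "r < b choose N" using b by (auto simp: r_def)
    then have "N > 0" using False by (cases N) auto
    then obtain \<delta> a where a: "macaulay_rep r N \<delta> a" "a N < b"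
      using Suc.IH[of r b] False r by auto
    have "a j \<le> a N" if "j \<in> {\<delta>..N}" for j
      using a(1) that strict_mono_onD[of "{\<delta>..N}" a j N] by (cases "j = N") (auto simp: macaulay_rep_def)
    then have "macaulay_rep A (Suc N) \<delta> (a(Suc N := b))"
      using a r b le_less_trans[OF _ a(2)] unfolding macaulay_rep_def
      by (auto simp: strict_mono_on_def sum.cl_ivl_Suc le_Suc_eq)
    then show ?thesis using \<open>b < c\<close> by fastforce
  qed
qed auto

lemma macaulay_shift_eq_growth:
  assumes "A > 0" "N > 0"
  shows "macaulay_shift A N 0 (int l) = (growth N ^^ l) A"
proof -
  obtain M where "N = Suc M" using assms(2) by (cases N) auto
  then have "A < A + N choose N" using le_choose[of M "A + N"] by auto
  then obtain \<delta> a where rep: "macaulay_rep A N \<delta> a" using macaulay_rep_exists[OF assms] by blast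
  \<comment> \<open>Every representation yields this same value, which makes the definite
    description in \<open>macaulay_shift\<close> well defined although \<open>a\<close> is free
    outside \<open>{\<delta>..N}\<close>.\<close>
  have eq: "(\<Sum>j=\<delta>..N. int_choose (int (a j) + int l) (int j + 0)) = (growth N ^^ l) A"
    if "macaulay_rep A N \<delta> a" for \<delta> a
  proof -
    have "int_choose (int (a j) + int l) (int j + 0) = a j + l choose j" if "j \<in> {\<delta>..N}" for j
    proof -
      have "j \<le> a j" using \<open>macaulay_rep A N \<delta> a\<close> that by (auto simp: macaulay_rep_def)
      then show ?thesis by (simp add: int_choose_def nat_int_add)
    qed
    then show ?thesis unfolding iterated_growth_macaulay_rep(1)[OF that] by (intro sum.cong) auto
  qed
  show ?thesis unfolding macaulay_shift_def
    by (rule the_equality) (use rep eq in \<open>blast | metis\<close>)+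
qed

section \<open>Sumsets with a simplex\<close>

definition bump :: "'a \<Rightarrow> ('a \<Rightarrow> nat) \<Rightarrow> 'a \<Rightarrow> nat" where
  "bump i \<alpha> = \<alpha>(i := Suc (\<alpha> i))"

text \<open>The set on the right is \<open>A\<close> plus the vertices of the simplex, 0 and the
  unit vectors for \<open>I\<close>. By the last hypothesis \<open>A\<close> varies only in the
  coordinates \<open>I\<close>, so a slice is treated by removing one index from \<open>I\<close>
  with no change of type. For empty \<open>I\<close> there is at most one point, matching
  \<open>growth 0\<close>.\<close>

lemma card_simplex_sumset:
  assumes "finite I" "finite A" "\<And>\<alpha> \<beta> i. \<alpha> \<in> A \<Longrightarrow> \<beta> \<in> A \<Longrightarrow> i \<notin> I \<Longrightarrow> \<alpha> i = \<beta> i"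
  shows "growth (card I) (card A) \<le> card (A \<union> (\<Union>i\<in>I. bump i ` A))"
  using assms
proof (induction I arbitrary: A rule: finite_induct)
  case empty
  then have "\<alpha> = \<beta>" if "\<alpha> \<in> A" "\<beta> \<in> A" for \<alpha> \<beta> using that by auto
  then show ?case by simp
next
  case (insert j I)
  let ?N = "\<lambda>I A. A \<union> (\<Union>i\<in>I. bump i ` A)"
  from insert.prems show ?case
  proof (induction "card A" arbitrary: A rule: less_induct)
    case less
    note A = less.prems
    show ?case
    proof (cases "A = {}")
      case False
      define m where "m = Min ((\<lambda>\<alpha>. \<alpha> j) ` A)"
      have m: "m \<le> \<alpha> j" if "\<alpha> \<in> A" for \<alpha> using that A(1) by (auto simp: m_def)
      have "m \<in> (\<lambda>\<alpha>. \<alpha> j) ` A" unfolding m_def using A(1) False by (intro Min_in) auto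
      then obtain \<alpha>0 where \<alpha>0: "\<alpha>0 \<in> A" "\<alpha>0 j = m" by auto
      define A0 where "A0 = {\<alpha> \<in> A. \<alpha> j = m}"
      have sub: "A0 \<subseteq> A" "finite A0" "\<alpha>0 \<in> A0" using A(1) \<alpha>0 by (auto simp: A0_def)
      then have s: "card A0 \<le> card A" "card A0 > 0" "card (A - A0) = card A - card A0"
        using A(1) by (auto intro: card_mono simp: card_gt_0_iff card_Diff_subset)
      have fin: "finite (?N J B)" if "J \<subseteq> insert j I" "B \<subseteq> A" for J B
        using that A(1) insert.hyps(1) by (auto dest: finite_subset)
      have lowest: "growth (card I) (card A0) \<le> card (?N I A0)"
      proof (rule insert.IH)
        fix \<alpha> \<beta> i assume "\<alpha> \<in> A0" "\<beta> \<in> A0" "i \<notin> I"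
        then show "\<alpha> i = \<beta> i" using A(2)[of \<alpha> \<beta> i] by (cases "i = j") (auto simp: A0_def)
      qed (rule sub)
      have level: "\<alpha> j = m" if "\<alpha> \<in> ?N I A0" for \<alpha>
        using that insert.hyps(2) by (auto simp: bump_def A0_def)
      \<comment> \<open>The sumset of the lowest slice in the directions \<open>I\<close> stays at
        height \<open>m\<close>, so anything strictly higher is counted separately.\<close>
      have card_le: "card (?N I A0) + card B \<le> card (?N (insert j I) A)"
        if "B \<subseteq> ?N (insert j I) A" "\<And>\<alpha>. \<alpha> \<in> B \<Longrightarrow> m < \<alpha> j" for B
      proof -
        have "?N I A0 \<union> B \<subseteq> ?N (insert j I) A" using that(1) sub(1) by blast
        then have "card (?N I A0 \<union> B) \<le> card (?N (insert j I) A)"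
          using fin by (intro card_mono) auto
        moreover have "\<alpha> \<notin> B" if "\<alpha> \<in> ?N I A0" for \<alpha>
          using level[OF that] \<open>\<And>\<alpha>. \<alpha> \<in> B \<Longrightarrow> m < \<alpha> j\<close>[of \<alpha>] by linarith
        then have "?N I A0 \<inter> B = {}" by blast
        moreover have "finite B" using that(1) fin[of "insert j I" A] finite_subset by blast
        moreover have "finite (?N I A0)" using fin sub by blast
        ultimately show ?thesis using card_Un_disjoint by metis
      qed
      have "inj (bump j)"
      proof (intro injI ext)
        fix \<alpha> \<beta> i assume "bump j \<alpha> = bump j \<beta>"
        then have "bump j \<alpha> i = bump j \<beta> i" by simp
        then show "\<alpha> i = \<beta> i" by (auto simp: bump_def split: if_splits)
      qed
      then have card_bump: "card (bump j ` A) = card A" by (simp add: card_image inj_on_subset)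
      \<comment> \<open>First candidate for the upper part: all of \<open>A\<close> raised by one in
        direction \<open>j\<close>.\<close>
      have 1: "card (?N I A0) + card A \<le> card (?N (insert j I) A)"
        unfolding card_bump[symmetric]
      proof (rule card_le)
        show "m < \<alpha> j" if "\<alpha> \<in> bump j ` A" for \<alpha>
          using that m by (auto simp: bump_def less_Suc_eq_le)
      qed blast
      \<comment> \<open>Second candidate: the sumset of the higher slices. The lowest slice is
        nonempty, so the inner induction on the size applies.\<close>
      have "growth (card (insert j I)) (card (A - A0)) \<le> card (?N (insert j I) (A - A0))"
        using A s sub by (intro less.hyps) auto
      moreover have "card (?N I A0) + card (?N (insert j I) (A - A0)) \<le> card (?N (insert j I) A)"
      proof (rule card_le)
        fix \<alpha> assume "\<alpha> \<in> ?N (insert j I) (A - A0)"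
        then obtain \<beta> where "\<beta> \<in> A - A0" "\<beta> j \<le> \<alpha> j" by (auto simp: bump_def)
        then show "m < \<alpha> j" using m[of \<beta>] by (auto simp: A0_def)
      qed auto
      ultimately show ?thesis
        using growth_peel[OF s(1), of "card I"] 1 lowest s(3) insert.hyps by auto
    qed simp
  qed
qed

lemma sum_bump: "finite A \<Longrightarrow> i \<in> A \<Longrightarrow> sum (bump i \<alpha>) A = Suc (sum \<alpha> A)"
  by (simp add: bump_def sum.remove)

text \<open>In fixed degree the other exponents determine that of \<open>k\<close>, so erasing it is
  injective on \<open>A\<close>. Multiplication by variable \<open>k\<close> then becomes the
  identity, which supplies the vertex 0 of the simplex.\<close>

lemma card_multiples_ge:
  fixes A :: "('n::finite \<Rightarrow> nat) set"
  assumes "finite A" "\<And>\<alpha>. \<alpha> \<in> A \<Longrightarrow> sum \<alpha> UNIV = d"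
  shows "growth (CARD('n) - 1) (card A) \<le> card (\<Union>i. bump i ` A)"
proof -
  obtain k :: 'n where True by auto
  let ?p = "\<lambda>\<alpha> :: 'n \<Rightarrow> nat. \<alpha>(k := 0)"
  have "inj_on ?p A"
  proof (rule inj_onI)
    fix \<alpha> \<beta> assume *: "\<alpha> \<in> A" "\<beta> \<in> A" "?p \<alpha> = ?p \<beta>"
    then have eq: "\<alpha> i = \<beta> i" if "i \<noteq> k" for i using that by (metis fun_upd_apply)
    then have "sum \<alpha> (UNIV - {k}) = sum \<beta> (UNIV - {k})" by (intro sum.cong) auto
    then have "\<alpha> k = \<beta> k" using assms(2) * by (metis UNIV_I add_right_cancel finite_code sum.remove)
    then show "\<alpha> = \<beta>" using eq by (intro ext) metis
  qed
  then have "growth (CARD('n) - 1) (card A) = growth (card (UNIV - {k})) (card (?p ` A))"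
    by (simp add: card_image card_Diff_subset)
  also have "\<dots> \<le> card (?p ` A \<union> (\<Union>i\<in>UNIV - {k}. bump i ` ?p ` A))"
    using assms(1) by (intro card_simplex_sumset) auto
  also have "?p ` A \<union> (\<Union>i\<in>UNIV - {k}. bump i ` ?p ` A) \<subseteq> ?p ` (\<Union>i. bump i ` A)"
  proof -
    have "?p (bump k \<alpha>) = ?p \<alpha>" "i \<noteq> k \<Longrightarrow> ?p (bump i \<alpha>) = bump i (?p \<alpha>)" for i \<alpha>
      by (auto simp: bump_def fun_eq_iff)
    then show ?thesis by (auto simp: image_iff) metis+
  qed
  then have "card (?p ` A \<union> (\<Union>i\<in>UNIV - {k}. bump i ` ?p ` A)) \<le> card (?p ` (\<Union>i. bump i ` A))"
    using assms(1) by (intro card_mono) auto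
  also have "\<dots> \<le> card (\<Union>i. bump i ` A)"
    using assms(1) by (intro card_image_le) auto
  finally show ?thesis .
qed

lemma card_iterated_multiples_ge:
  fixes A :: "('n::finite \<Rightarrow> nat) set"
  assumes "finite A" "\<And>\<alpha>. \<alpha> \<in> A \<Longrightarrow> sum \<alpha> UNIV = d"
  shows "(growth (CARD('n) - 1) ^^ l) (card A) \<le>
    card {\<lambda>i. \<alpha> i + \<gamma> i | \<alpha> \<gamma>. \<alpha> \<in> A \<and> sum \<gamma> UNIV = l}"
proof -
  define B where "B l = ((\<lambda>A. \<Union>i. bump i ` A) ^^ l) A" for l :: nat
  have B: "finite (B l)" "\<And>\<beta>. \<beta> \<in> B l \<Longrightarrow> \<exists>\<alpha>\<in>A. \<exists>\<gamma>. sum \<gamma> UNIV = l \<and> \<beta> = (\<lambda>i. \<alpha> i + \<gamma> i)" for l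
  proof (induction l)
    case 0
    {
      case 1 then show ?case using assms(1) by (simp add: B_def)
    next
      case (2 \<beta>)
      then show ?case by (intro bexI[of _ \<beta>] exI[of _ "\<lambda>_. 0"]) (auto simp: B_def)
    }
  next
    case (Suc l)
    {
      case 1 then show ?case using Suc by (simp add: B_def)
    next
      case (2 \<beta>)
      then obtain i \<beta>' where *: "\<beta> = bump i \<beta>'" "\<beta>' \<in> B l" by (auto simp: B_def)
      then obtain \<alpha> \<gamma> where "\<alpha> \<in> A" "sum \<gamma> UNIV = l" "\<beta>' = (\<lambda>i. \<alpha> i + \<gamma> i)"
        using Suc(2) by blast
      moreover from this have "sum (bump i \<gamma>) UNIV = Suc l" by (simp add: sum_bump)
      ultimately show ?case using *
        by (intro bexI[of _ \<alpha>] exI[of _ "bump i \<gamma>"] conjI) (auto simp: bump_def)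
    }
  qed
  \<comment> \<open>Homogeneity persists under the products, so the one-step bound can be applied
    again.\<close>
  have "sum \<beta> UNIV = d + l" if "\<beta> \<in> B l" for \<beta> l
    using B(2)[OF that] assms(2) by (auto simp: sum.distrib)
  then have "growth (CARD('n) - 1) (card (B l)) \<le> card (B (Suc l))" for l
    using card_multiples_ge[OF B(1)] by (auto simp: B_def)
  then have "(growth (CARD('n) - 1) ^^ l) (card A) \<le> card (B l)"
    by (induction l) (auto simp: B_def intro: order_trans[OF growth_mono])
  also have "\<dots> \<le> card {\<lambda>i. \<alpha> i + \<gamma> i | \<alpha> \<gamma>. \<alpha> \<in> A \<and> sum \<gamma> UNIV = l}"
  proof (rule card_mono)
    let ?G = "{\<gamma> :: 'n \<Rightarrow> nat. sum \<gamma> UNIV = l}"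
    have "?G \<subseteq> (UNIV :: 'n set) \<rightarrow>\<^sub>E {..l}" by (auto intro: member_le_sum)
    then have "finite ?G" by (rule finite_subset) (auto intro: finite_PiE)
    then have "finite ((\<lambda>(\<alpha>, \<gamma>) i. \<alpha> i + \<gamma> i) ` (A \<times> ?G))" using assms(1) by blast
    then show "finite {\<lambda>i. \<alpha> i + \<gamma> i | \<alpha> \<gamma>. \<alpha> \<in> A \<and> sum \<gamma> UNIV = l}"
      by (rule finite_subset[rotated]) auto
  qed (use B(2) in blast)
  finally show ?thesis .
qed

section \<open>Spectral decomposition of Hermitian matrices\<close>

text \<open>Gram-Schmidt on a basis beginning with \<open>v\<close> keeps \<open>v\<close> in front,
  and normalizing only rescales it; an eigenvector thus remains an eigenvector in the first
  column.\<close>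

lemma unitary_with_first_column:
  assumes v: "v \<in> carrier_vec n" "v \<noteq> 0\<^sub>v n" 
  obtains U :: "complex mat" and c :: complex where
    "U \<in> carrier_mat n n" "mat_adjoint U * U = 1\<^sub>m n" "U * mat_adjoint U = 1\<^sub>m n" "c \<noteq> 0"
    "col U 0 = c \<cdot>\<^sub>v v"
proof -
  have n: "n > 0" using v by (intro gr0I) auto
  interpret cof_vec_space n "TYPE(complex)" .
  define b where "b = basis_completion v"
  from basis_completion[OF v, folded b_def]
  have span_b: "span (set b) = carrier_vec n" and dist_b: "distinct b" 
    and indep: "\<not> lin_dep (set b)" and b: "set b \<subseteq> carrier_vec n" and hdb: "hd b = v" 
    and len_b: "length b = n" by auto
  from hdb len_b n obtain vs where bv: "b = v # vs" by (cases b) auto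
  define ws where "ws = gram_schmidt n b"
  from gram_schmidt_result[OF b dist_b indep refl, folded ws_def]
  have ws: "set ws \<subseteq> carrier_vec n" "corthogonal ws" "length ws = n" 
    by (auto simp: len_b)
  have hdws: "ws ! 0 = v"
    using gram_schmidt_hd[OF v(1), of vs, folded bv] n ws(3) unfolding ws_def
    by (metis hd_conv_nth length_greater_0_conv)
  have wsi: "ws ! i \<in> carrier_vec n" if "i < n" for i
    using ws that by auto
  define s where "s i = complex_of_real (sqrt (Re (ws ! i \<bullet>c ws ! i)))" for i
  have pos: "Re (ws ! i \<bullet>c ws ! i) > 0 \<and> ws ! i \<bullet>c ws ! i = complex_of_real (Re (ws ! i \<bullet>c ws ! i))" if "i < n" for i
  proof -
    have "ws ! i \<bullet>c ws ! i \<ge> 0" by (rule conjugate_square_ge_0_vec)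
    moreover have "ws ! i \<bullet>c ws ! i \<noteq> 0" using ws that by (auto simp: corthogonal_def)
    ultimately show ?thesis by (auto simp: less_eq_complex_def complex_eq_iff)
  qed
  have s: "s i \<noteq> 0" "cnj (s i) = s i" "s i * s i = ws ! i \<bullet>c ws ! i" if "i < n" for i
  proof -
    show "s i \<noteq> 0" "cnj (s i) = s i" using pos[OF that] by (auto simp: s_def)
    have "s i * s i = complex_of_real (Re (ws ! i \<bullet>c ws ! i))"
      using pos[OF that] by (simp add: s_def flip: of_real_mult)
    then show "s i * s i = ws ! i \<bullet>c ws ! i" using pos[OF that] by simp
  qed
  define U where "U = mat_of_cols n (map (\<lambda>i. (1 / s i) \<cdot>\<^sub>v (ws ! i)) [0..<n])"
  have U: "U \<in> carrier_mat n n" by (auto simp: U_def mat_of_cols_def)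
  have Uc: "col U i = (1 / s i) \<cdot>\<^sub>v (ws ! i)" if "i < n" for i
    using that wsi[OF that] by (simp add: U_def)
  have Ua: "mat_adjoint U \<in> carrier_mat n n" using U by (auto simp: mat_adjoint_def)
  have "mat_adjoint U * U = 1\<^sub>m n"
  proof (rule eq_matI)
    fix i j assume "i < dim_row (1\<^sub>m n :: complex mat)" "j < dim_col (1\<^sub>m n :: complex mat)"
    then have ij: "i < n" "j < n" by auto
    then have "(mat_adjoint U * U) $$ (i, j) = conjugate (col U i) \<bullet> col U j"
      using U Ua by (simp add: mat_adjoint_def)
    also have "\<dots> = col U j \<bullet>c col U i"
      using U ij by (intro comm_scalar_prod[of _ n]) auto
    also have "\<dots> = (1 / s j) * cnj (1 / s i) * (ws ! j \<bullet>c ws ! i)"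
      using wsi[OF ij(1)] wsi[OF ij(2)] ij Uc
      by (simp add: conjugate_smult_vec smult_scalar_prod_distrib[of _ n] scalar_prod_smult_distrib[of _ n])
    also have "\<dots> = (if i = j then 1 else 0)"
      using s[OF ij(1)] s[OF ij(2)] ij ws by (auto simp: corthogonal_def)
    finally show "(mat_adjoint U * U) $$ (i, j) = 1\<^sub>m n $$ (i, j)" using ij by simp
  qed (use U Ua in auto)
  moreover from mat_mult_left_right_inverse[OF Ua U this] have "U * mat_adjoint U = 1\<^sub>m n" .
  ultimately show ?thesis using that[of U "1 / s 0"] U Uc[OF n] s[OF n] hdws by auto
qed

lemma mat_adjoint_eq: "mat_adjoint A = mat (dim_col A) (dim_row A) (\<lambda>(i, j). conjugate (A $$ (j, i)))"
  by (rule eq_matI) (auto simp: mat_adjoint_def mat_of_rows_def)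

lemma mat_adjoint_mult:
  fixes A B :: "complex mat"
  assumes "A \<in> carrier_mat n m" "B \<in> carrier_mat m k"
  shows "mat_adjoint (A * B) = mat_adjoint B * mat_adjoint A"
proof (rule eq_matI)
  fix i j assume "i < dim_row (mat_adjoint B * mat_adjoint A)" "j < dim_col (mat_adjoint B * mat_adjoint A)"
  then have "i < k" "j < n" using assms by (auto simp: mat_adjoint_eq)
  then show "mat_adjoint (A * B) $$ (i, j) = (mat_adjoint B * mat_adjoint A) $$ (i, j)"
    using assms by (simp add: mat_adjoint_eq scalar_prod_def cnj_sum mult.commute)
qed (use assms in \<open>auto simp: mat_adjoint_eq\<close>)

lemma mat_adjoint_mat_adjoint: "mat_adjoint (mat_adjoint A) = A"
  by (rule eq_matI) (auto simp: mat_adjoint_eq)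

lemma assoc_mult_mat5:
  fixes A :: "'a::semiring_0 mat"
  assumes "A \<in> carrier_mat n n" "B \<in> carrier_mat n n" "C \<in> carrier_mat n n"
    "D \<in> carrier_mat n n" "E \<in> carrier_mat n n"
  shows "A * B * C * (D * E) = A * (B * C * D) * E"
  using assms by (simp add: assoc_mult_mat[of _ n n _ n _ n] mult_carrier_mat[of _ n n _ n])

text \<open>Deflation: in a unitary basis that begins with an eigenvector the first column is a
  multiple of the first unit vector, Hermitian symmetry clears the first row as well, and the
  remaining block is Hermitian of smaller size.\<close>

lemma hermitian_spectral_decomposition:
  fixes A :: "complex mat"
  assumes "A \<in> carrier_mat n n" "mat_adjoint A = A"
  obtains P ds where "P \<in> carrier_mat n n" "mat_adjoint P * P = 1\<^sub>m n" "P * mat_adjoint P = 1\<^sub>m n"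
    "length ds = n" "A = P * mat n n (\<lambda>(i, j). if i = j then complex_of_real (ds ! i) else 0) * mat_adjoint P"
proof -
  let ?D = "\<lambda>ds. mat (length ds) (length ds) (\<lambda>(i, j). if i = j then complex_of_real (ds ! i) else 0)"
  have "\<exists>P ds. P \<in> carrier_mat n n \<and> mat_adjoint P * P = 1\<^sub>m n \<and> length ds = n \<and> A = P * ?D ds * mat_adjoint P"
    using assms
  proof (induction n arbitrary: A)
    case 0
    then show ?case by (intro exI[of _ A] exI[of _ "[]"]) (auto simp: mat_adjoint_eq)
  next
    case (Suc n)
    note A = Suc.prems(1)
    obtain as where as: "char_poly A = (\<Prod>a\<leftarrow>as. [:- a, 1:])" "length as = Suc n"
      using char_poly_factorized[OF A] by auto
    then obtain e es where "as = e # es" by (cases as) auto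
    then have "eigenvalue A e" unfolding eigenvalue_root_char_poly[OF A] as by simp
    then obtain v where v: "v \<in> carrier_vec (Suc n)" "v \<noteq> 0\<^sub>v (Suc n)" "A *\<^sub>v v = e \<cdot>\<^sub>v v"
      using A by (auto simp: eigenvalue_def eigenvector_def)
    obtain U c where U: "U \<in> carrier_mat (Suc n) (Suc n)" "mat_adjoint U * U = 1\<^sub>m (Suc n)"
      "U * mat_adjoint U = 1\<^sub>m (Suc n)" "col U 0 = c \<cdot>\<^sub>v v"
      using unitary_with_first_column[OF v(1,2)] by metis
    have Ua: "mat_adjoint U \<in> carrier_mat (Suc n) (Suc n)" using U by (simp add: mat_adjoint_eq)
    define B where "B = mat_adjoint U * A * U"
    have B: "B \<in> carrier_mat (Suc n) (Suc n)" using U A Ua by (simp add: B_def)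
    have hermB: "mat_adjoint B = B"
      using U A Ua Suc.prems(2) unfolding B_def
      by (simp add: mat_adjoint_mult[of _ "Suc n" "Suc n" _ "Suc n"] mat_adjoint_mat_adjoint assoc_mult_mat[of _ "Suc n" "Suc n" _ "Suc n" _ "Suc n"])
    have "B = mat_adjoint U * (A * U)"
      unfolding B_def using U A Ua by (intro assoc_mult_mat) auto
    then have "col B 0 = mat_adjoint U *\<^sub>v col (A * U) 0"
      using col_mult2[of "mat_adjoint U" "Suc n" "Suc n" "A * U" "Suc n" 0] U A Ua by simp
    also have "col (A * U) 0 = A *\<^sub>v col U 0"
      using U A by (intro col_mult2) auto
    also have "A *\<^sub>v col U 0 = e \<cdot>\<^sub>v col U 0"
      unfolding U(4) using A v by (simp add: mult_mat_vec smult_smult_assoc mult.commute)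
    also have "mat_adjoint U *\<^sub>v (e \<cdot>\<^sub>v col U 0) = e \<cdot>\<^sub>v (mat_adjoint U *\<^sub>v col U 0)"
      using Ua carrier_vecI[of "col U 0" "Suc n"] U(1) by (intro mult_mat_vec[of _ "Suc n" "Suc n"]) simp_all
    also have "mat_adjoint U *\<^sub>v col U 0 = col (mat_adjoint U * U) 0"
      by (rule col_mult2[OF Ua U(1), symmetric]) simp
    also have "\<dots> = unit_vec (Suc n) 0" unfolding U(2) by simp
    finally have colB: "col B 0 = e \<cdot>\<^sub>v unit_vec (Suc n) 0" .
    have B0: "B $$ (i, 0) = (if i = 0 then e else 0)" if "i < Suc n" for i
      using arg_cong[OF colB, of "\<lambda>x. x $ i"] B that by auto
    have hB: "B $$ (i, j) = cnj (B $$ (j, i))" if "i < Suc n" "j < Suc n" for i j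
      using arg_cong[OF hermB, of "\<lambda>x. x $$ (i, j)"] B that by (simp add: mat_adjoint_eq)
    \<comment> \<open>The corner entry equals its own conjugate, so the eigenvalue is real.\<close>
    have e: "e = complex_of_real (Re e)" using hB[of 0 0] B0[of 0] by (auto simp: complex_eq_iff)
    define C where "C = mat n n (\<lambda>(i, j). B $$ (Suc i, Suc j))"
    have C: "C \<in> carrier_mat n n" by (simp add: C_def)
    have "mat_adjoint C = C" by (intro eq_matI) (auto simp: mat_adjoint_eq C_def hB[symmetric])
    from Suc.IH[OF C this] obtain P ds where P: "P \<in> carrier_mat n n" "mat_adjoint P * P = 1\<^sub>m n"
      "length ds = n" "C = P * ?D ds * mat_adjoint P" by auto
    have Pa: "mat_adjoint P \<in> carrier_mat n n" using P by (simp add: mat_adjoint_eq)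
    have D: "?D ds \<in> carrier_mat n n" using P by simp
    \<comment> \<open>Bordering by a scalar is compatible with products and adjoints, so the
      diagonalization of \<open>C\<close> extends to \<open>B\<close>.\<close>
    let ?F = "\<lambda>x X. four_block_mat (mat 1 1 (\<lambda>_. x)) (0\<^sub>m 1 n) (0\<^sub>m n 1) X :: complex mat"
    have F: "?F x X \<in> carrier_mat (Suc n) (Suc n)" if "X \<in> carrier_mat n n" for x X
      using four_block_carrier_mat[of "mat 1 1 (\<lambda>_. x)" 1 1 X n n] that by simp
    have Fmult: "?F x X * ?F y Y = ?F (x * y) (X * Y)" if "X \<in> carrier_mat n n" "Y \<in> carrier_mat n n" for x y X Y
    proof -
      have "mat 1 1 (\<lambda>_. x) * mat 1 1 (\<lambda>_. y) = mat 1 1 (\<lambda>_. x * y)"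
        by (rule eq_matI) (auto simp: scalar_prod_def)
      then show ?thesis using that
        by (subst mult_four_block_mat[of _ 1 1 _ n _ n _ _ 1 _ n]) auto
    qed
    have Fadj: "mat_adjoint (?F x X) = ?F (cnj x) (mat_adjoint X)" if "X \<in> carrier_mat n n" for x X
      using that by (intro eq_matI) (auto simp: mat_adjoint_eq)
    have F1: "?F 1 (1\<^sub>m n) = 1\<^sub>m (Suc n)" by (rule eq_matI) auto
    have BF: "B = ?F e C"
    proof (rule eq_matI)
      fix i j assume "i < dim_row (?F e C)" "j < dim_col (?F e C)"
      then show "B $$ (i, j) = ?F e C $$ (i, j)"
        using B0[of i] B0[of j] hB[of i j] C by (cases i; cases j) (auto simp: C_def)
    qed (use B C in auto)
    have DF: "?D (Re e # ds) = ?F e (?D ds)"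
      using e P(3) by (intro eq_matI) (auto simp: nth_Cons')
    define Q where "Q = U * ?F 1 P"
    have Q: "Q \<in> carrier_mat (Suc n) (Suc n)" using U F[OF P(1)] by (simp add: Q_def)
    have Qadj: "mat_adjoint Q = ?F 1 (mat_adjoint P) * mat_adjoint U"
      unfolding Q_def using U F[OF P(1)] Fadj[OF P(1)] by (subst mat_adjoint_mult) auto
    note carr = U(1) Ua F[OF P(1)] F[OF Pa] F[OF D] A B
    note assoc = assoc_mult_mat[of _ "Suc n" "Suc n" _ "Suc n" _ "Suc n"]
    have "mat_adjoint Q * Q = ?F 1 (mat_adjoint P) * (mat_adjoint U * U) * ?F 1 P"
      unfolding Qadj unfolding Q_def using carr by (simp add: assoc del: U(2))
    also have "\<dots> = 1\<^sub>m (Suc n)"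
      unfolding U(2) right_mult_one_mat[OF F[OF Pa]] Fmult[OF Pa P(1)] P(2) using F1 by simp
    finally have 1: "mat_adjoint Q * Q = 1\<^sub>m (Suc n)" .
    have "Q * ?D (Re e # ds) * mat_adjoint Q = U * (?F 1 P * ?F e (?D ds) * ?F 1 (mat_adjoint P)) * mat_adjoint U"
      unfolding Qadj DF unfolding Q_def using carr by (intro assoc_mult_mat5) auto
    also have "?F 1 P * ?F e (?D ds) * ?F 1 (mat_adjoint P) = B"
      unfolding BF using Fmult P D Pa by simp
    also have "U * B * mat_adjoint U = (U * mat_adjoint U) * A * (U * mat_adjoint U)"
      unfolding B_def using carr by (intro assoc_mult_mat5[symmetric]) auto
    also have "\<dots> = A" unfolding U(3) using A by simp
    finally show ?case using Q 1 P(3) by (intro exI[of _ Q] exI[of _ "Re e # ds"]) auto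
  qed
  then obtain P ds where P: "P \<in> carrier_mat n n" "mat_adjoint P * P = 1\<^sub>m n" "length ds = n"
    "A = P * ?D ds * mat_adjoint P" by auto
  moreover have "P * mat_adjoint P = 1\<^sub>m n"
    using P by (intro mat_mult_left_right_inverse[of "mat_adjoint P" n]) (auto simp: mat_adjoint_eq)
  ultimately show ?thesis using that[of P ds] by auto
qed

section \<open>Leading monomials and spans\<close>

interpretation cfun: vector_space "\<lambda>(c :: complex) (f :: 'a \<Rightarrow> complex) x. c * f x"
proof unfold_locales
  fix a b :: complex and x y :: "'a \<Rightarrow> complex"
  show "(\<lambda>xa. a * (x + y) xa) = (\<lambda>xa. a * x xa) + (\<lambda>xa. a * y xa)" by (rule ext) (simp add: distrib_left)
  show "(\<lambda>xa. (a + b) * x xa) = (\<lambda>xa. a * x xa) + (\<lambda>xa. b * x xa)" by (rule ext) (simp add: distrib_right)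
qed (simp_all add: mult.assoc)

text \<open>Provides linear functionals on coefficient functions, by which membership in a span is
  tested.\<close>

interpretation cfun_dual: vector_space_pair
  "\<lambda>(c :: complex) (f :: 'a \<Rightarrow> complex) x. c * f x" "(*) :: complex \<Rightarrow> complex \<Rightarrow> complex"
  by unfold_locales (simp_all add: distrib_left distrib_right)

lemma sum_fun_apply: "(\<Sum>a\<in>A. g a) x = (\<Sum>a\<in>A. g a x)"
  by (induction A rule: infinite_finite_induct) simp_all

text \<open>Ties in \<open>w\<close> are allowed; a leading index is unique once \<open>w\<close> is
  injective on the support.\<close>

definition leading :: "('a \<Rightarrow> nat) \<Rightarrow> ('a \<Rightarrow> complex) \<Rightarrow> 'a \<Rightarrow> bool" where
  "leading w f \<alpha> \<longleftrightarrow> f \<alpha> \<noteq> 0 \<and> (\<forall>\<beta>. f \<beta> \<noteq> 0 \<longrightarrow> w \<beta> \<le> w \<alpha>)"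

text \<open>Elimination: with one element chosen for each leading index, subtracting multiples of
  these lowers the largest weight of any given element until nothing is left, so the chosen elements
  span.\<close>

lemma card_le_leading:
  assumes "finite S" "inj_on w S"
    and ind: "cfun.independent B" and supp: "\<And>f \<alpha>. f \<in> cfun.span B \<Longrightarrow> f \<alpha> \<noteq> 0 \<Longrightarrow> \<alpha> \<in> S"
  shows "card B \<le> card {\<alpha>. \<exists>f\<in>cfun.span B. leading w f \<alpha>}"
proof -
  let ?V = "cfun.span B"
  let ?L = "{\<alpha>. \<exists>f\<in>?V. leading w f \<alpha>}"
  have "?L \<subseteq> S" using supp by (auto simp: leading_def)
  then have finL: "finite ?L" using assms(1) finite_subset by blast
  obtain h where h: "\<And>\<alpha>. \<alpha> \<in> ?L \<Longrightarrow> h \<alpha> \<in> ?V \<and> leading w (h \<alpha>) \<alpha>"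
    using bchoice[of ?L "\<lambda>\<alpha> f. f \<in> ?V \<and> leading w f \<alpha>"] by auto
  have "f \<in> cfun.span (h ` ?L)" if "f \<in> ?V" "\<And>\<beta>. f \<beta> \<noteq> 0 \<Longrightarrow> w \<beta> < k" for f k
    using that
  proof (induction k arbitrary: f)
    case 0
    then have "f = 0" by (auto simp: fun_eq_iff)
    then show ?case using cfun.span_zero by (simp only:)
  next
    case (Suc k)
    show ?case
    proof (cases "\<exists>\<alpha>. f \<alpha> \<noteq> 0 \<and> w \<alpha> = k")
      case False
      then have "w \<beta> < k" if "f \<beta> \<noteq> 0" for \<beta>
        using Suc.prems(2)[OF that] that by (auto simp: less_Suc_eq)
      then show ?thesis using Suc.IH Suc.prems(1) by blast
    next
      case True
      then obtain \<alpha> where \<alpha>: "f \<alpha> \<noteq> 0" "w \<alpha> = k" by auto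
      then have "leading w f \<alpha>" using Suc.prems(2) by (auto simp: leading_def less_Suc_eq_le)
      then have L: "\<alpha> \<in> ?L" using Suc.prems(1) by blast
      note h\<alpha> = h[OF L, THEN conjunct1] h[OF L, THEN conjunct2, unfolded leading_def]
      define g where "g = f - (\<lambda>\<beta>. f \<alpha> / h \<alpha> \<alpha> * h \<alpha> \<beta>)"
      have gV: "g \<in> ?V" unfolding g_def using Suc.prems(1) h\<alpha>(1) by (intro cfun.span_diff cfun.span_scale)
      have "w \<beta> < k" if "g \<beta> \<noteq> 0" for \<beta>
      proof -
        have "f \<beta> \<noteq> 0 \<or> h \<alpha> \<beta> \<noteq> 0" using that by (auto simp: g_def)
        then have "w \<beta> \<le> k" using Suc.prems(2) h\<alpha>(2) \<alpha>(2) by (auto simp: less_Suc_eq_le)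
        \<comment> \<open>Injectivity of \<open>w\<close> leaves \<alpha> as the only index of
          weight \<open>k\<close>, and \<open>g\<close> vanishes there.\<close>
        moreover have "w \<beta> \<noteq> k"
        proof
          assume "w \<beta> = k"
          then have "\<beta> = \<alpha>" using supp[OF gV that] supp[OF Suc.prems(1) \<alpha>(1)] \<alpha>(2) assms(2)
            by (auto dest: inj_onD)
          then show False using that h\<alpha>(2) by (simp add: g_def)
        qed
        ultimately show ?thesis by simp
      qed
      then have "g \<in> cfun.span (h ` ?L)" using Suc.IH gV by blast
      moreover have "(\<lambda>\<beta>. f \<alpha> / h \<alpha> \<alpha> * h \<alpha> \<beta>) \<in> cfun.span (h ` ?L)"
        using L by (intro cfun.span_scale cfun.span_base) blast
      ultimately have "g + (\<lambda>\<beta>. f \<alpha> / h \<alpha> \<alpha> * h \<alpha> \<beta>) \<in> cfun.span (h ` ?L)"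
        by (rule cfun.span_add)
      then show ?thesis by (simp add: g_def)
    qed
  qed
  moreover have "w \<beta> < Suc (Max (w ` S))" if "f \<in> ?V" "f \<beta> \<noteq> 0" for f \<beta>
    using supp[OF that] assms(1) by (simp add: less_Suc_eq_le)
  ultimately have "B \<subseteq> cfun.span (h ` ?L)" using cfun.span_base by blast
  then have "card B \<le> card (h ` ?L)"
    using cfun.independent_span_bound[OF _ ind] finL by blast
  also have "\<dots> \<le> card ?L" using finL by (rule card_image_le)
  finally show ?thesis .
qed

text \<open>Elements with distinct leading indices are independent: in a linear relation, the
  heaviest leading index with nonzero coefficient receives a contribution from a single
  element.\<close>

lemma card_leading_le:
  assumes "finite T" "finite L" "inj_on w L" "\<And>\<alpha>. \<alpha> \<in> L \<Longrightarrow> \<exists>f\<in>cfun.span T. leading w f \<alpha>"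
  shows "card L \<le> card T"
proof -
  obtain h where h: "\<And>\<alpha>. \<alpha> \<in> L \<Longrightarrow> h \<alpha> \<in> cfun.span T" "\<And>\<alpha>. \<alpha> \<in> L \<Longrightarrow> leading w (h \<alpha>) \<alpha>"
    using bchoice[of L "\<lambda>\<alpha> f. f \<in> cfun.span T \<and> leading w f \<alpha>"] assms(4) by auto
  have inj: "inj_on h L"
  proof (rule inj_onI)
    fix \<alpha> \<beta> assume *: "\<alpha> \<in> L" "\<beta> \<in> L" "h \<alpha> = h \<beta>"
    then have "w \<alpha> = w \<beta>" using h(2)[of \<alpha>] h(2)[of \<beta>] by (auto simp: leading_def intro: antisym)
    then show "\<alpha> = \<beta>" using assms(3) * by (auto dest: inj_onD)
  qed
  have "cfun.independent (h ` L)"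
  proof (rule cfun.independent_if_scalars_zero)
    fix c f assume zero: "(\<Sum>f\<in>h ` L. (\<lambda>x. c f * f x)) = 0" and f: "f \<in> h ` L"
    have sum0: "(\<Sum>\<beta>\<in>L. c (h \<beta>) * h \<beta> x) = 0" for x
      using fun_cong[OF zero, of x] by (simp add: sum_fun_apply sum.reindex[OF inj])
    show "c f = 0"
    proof (rule ccontr)
      assume "c f \<noteq> 0"
      define X where "X = {\<beta>\<in>L. c (h \<beta>) \<noteq> 0}"
      have "X \<noteq> {}" "finite X" using \<open>c f \<noteq> 0\<close> f assms(2) by (auto simp: X_def)
      then have "Max (w ` X) \<in> w ` X" "\<And>\<beta>. \<beta> \<in> X \<Longrightarrow> w \<beta> \<le> Max (w ` X)" by auto
      then obtain \<alpha> where \<alpha>: "\<alpha> \<in> L" "c (h \<alpha>) \<noteq> 0" "\<And>\<beta>. \<beta> \<in> L \<Longrightarrow> c (h \<beta>) \<noteq> 0 \<Longrightarrow> w \<beta> \<le> w \<alpha>"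
        by (auto simp: X_def)
      have "c (h \<beta>) * h \<beta> \<alpha> = 0" if "\<beta> \<in> L - {\<alpha>}" for \<beta>
      proof (rule ccontr)
        assume *: "c (h \<beta>) * h \<beta> \<alpha> \<noteq> 0"
        then have "w \<alpha> \<le> w \<beta>" using h(2)[of \<beta>] that by (auto simp: leading_def)
        then have "w \<alpha> = w \<beta>" using \<alpha>(3)[of \<beta>] * that by (auto intro: antisym)
        then show False using assms(3) that \<alpha>(1) by (auto dest: inj_onD)
      qed
      then have "(\<Sum>\<beta>\<in>L - {\<alpha>}. c (h \<beta>) * h \<beta> \<alpha>) = 0" by (rule sum.neutral[OF ballI])
      then have "(\<Sum>\<beta>\<in>L. c (h \<beta>) * h \<beta> \<alpha>) = c (h \<alpha>) * h \<alpha> \<alpha>"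
        using sum.remove[OF assms(2) \<alpha>(1), of "\<lambda>\<beta>. c (h \<beta>) * h \<beta> \<alpha>"] by simp
      then show False using sum0[of \<alpha>] \<alpha> h(2)[of \<alpha>] by (auto simp: leading_def)
    qed
  qed (use assms(2) in auto)
  then have "card (h ` L) \<le> card T"
    using cfun.independent_span_bound[OF assms(1)] h(1) by blast
  then show ?thesis using inj by (simp add: card_image)
qed

text \<open>Double annihilator: outside the span, some functional is 1 at \<open>f\<close> and 0 on
  \<open>T\<close>. On functions supported in the finite set \<open>S\<close> it is a pairing with
  some \<phi>.\<close>

lemma in_span_by_functionals:
  assumes "finite S" "\<And>\<alpha>. \<alpha> \<notin> S \<Longrightarrow> f \<alpha> = 0" "\<And>t \<alpha>. t \<in> T \<Longrightarrow> \<alpha> \<notin> S \<Longrightarrow> t \<alpha> = 0"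
    and ann: "\<And>\<phi>. (\<And>t. t \<in> T \<Longrightarrow> (\<Sum>\<alpha>\<in>S. \<phi> \<alpha> * t \<alpha>) = 0) \<Longrightarrow> (\<Sum>\<alpha>\<in>S. \<phi> \<alpha> * f \<alpha>) = 0"
  shows "f \<in> cfun.span T"
proof (rule ccontr)
  assume notin: "f \<notin> cfun.span T"
  obtain B where B: "B \<subseteq> T" "cfun.independent B" "T \<subseteq> cfun.span B"
    using cfun.maximal_independent_subset by blast
  then have "f \<notin> cfun.span B" using notin cfun.span_mono by blast
  then have "cfun.independent (insert f B)" using B by (intro cfun.independent_insertI)
  then obtain F where F: "Vector_Spaces.linear (\<lambda>c f x. c * f x) (*) F" "\<And>x. x \<in> insert f B \<Longrightarrow> F x = (if x = f then 1 else 0)"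
    using cfun_dual.linear_independent_extend[of "insert f B" "\<lambda>x. if x = f then 1 else 0"] by blast
  interpret F: Vector_Spaces.linear "\<lambda>c f x. c * f x" "(*)" F by (rule F(1))
  \<comment> \<open>The vector \<phi> consists of the values of \<open>F\<close> on the indicator
    functions of the points of \<open>S\<close>.\<close>
  have F_eq: "F g = (\<Sum>\<alpha>\<in>S. F (\<lambda>x. if x = \<alpha> then 1 else 0) * g \<alpha>)" if "\<And>\<alpha>. \<alpha> \<notin> S \<Longrightarrow> g \<alpha> = 0" for g
  proof -
    have "g = (\<Sum>\<alpha>\<in>S. (\<lambda>x. g \<alpha> * (if x = \<alpha> then 1 else 0)))"
    proof
      fix x
      have "(\<Sum>\<alpha>\<in>S. (\<lambda>x. g \<alpha> * (if x = \<alpha> then 1 else 0))) x = (\<Sum>\<alpha>\<in>S. g \<alpha> * (if x = \<alpha> then 1 else 0))"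
        by (rule sum_fun_apply)
      also have "\<dots> = g x" using assms(1) that by (simp add: if_distrib cong: if_cong)
      finally show "g x = (\<Sum>\<alpha>\<in>S. (\<lambda>x. g \<alpha> * (if x = \<alpha> then 1 else 0))) x" by simp
    qed
    then have "F g = F (\<Sum>\<alpha>\<in>S. (\<lambda>x. g \<alpha> * (if x = \<alpha> then 1 else 0)))" by simp
    also have "\<dots> = (\<Sum>\<alpha>\<in>S. g \<alpha> * F (\<lambda>x. if x = \<alpha> then 1 else 0))"
      by (simp only: F.sum F.scale)
    finally show ?thesis by (simp add: mult.commute)
  qed
  have "f \<notin> B" using \<open>f \<notin> cfun.span B\<close> cfun.span_base by blast
  then have "F b = 0" if "b \<in> B" for b using F(2)[of b] that by auto
  then have "F t = 0" if "t \<in> T" for t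
    using F.eq_0_on_span[of B t] B(3) that by blast
  then have "(\<Sum>\<alpha>\<in>S. F (\<lambda>x. if x = \<alpha> then 1 else 0) * t \<alpha>) = 0" if "t \<in> T" for t
    using F_eq[of t] assms(3) that by simp
  then have "(\<Sum>\<alpha>\<in>S. F (\<lambda>x. if x = \<alpha> then 1 else 0) * f \<alpha>) = 0" by (rule ann)
  then show False using F_eq[of f] assms(2) F(2)[of f] by simp
qed

section \<open>Uniqueness of the coefficients\<close>

lemma power_sum_coeffs_eq_0:
  fixes a :: "'a \<Rightarrow> complex" and w :: "'a \<Rightarrow> nat"
  assumes "finite S" "inj_on w S" "\<And>u. (\<Sum>\<alpha>\<in>S. a \<alpha> * u ^ w \<alpha>) = 0" "\<alpha> \<in> S"
  shows "a \<alpha> = 0"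
proof -
  let ?p = "\<Sum>\<beta>\<in>S. Polynomial.monom (a \<beta>) (w \<beta>)"
  have "poly ?p u = 0" for u using assms(3)[of u] by (simp add: poly_sum poly_monom)
  then have "?p = 0" using poly_all_0_iff_0 by blast
  then have "0 = Polynomial.coeff ?p (w \<alpha>)" by simp
  also have "\<dots> = (\<Sum>\<beta>\<in>S. if \<beta> = \<alpha> then a \<beta> else 0)"
    unfolding Polynomial.coeff_sum using assms(2,4) by (intro sum.cong) (auto dest: inj_onD)
  finally show ?thesis using assms(1,4) by simp
qed

lemma poly_eq_0_if_zero_on_reals:
  fixes p :: "complex poly"
  assumes "\<And>x. poly p (complex_of_real x) = 0"
  shows "p = 0"
proof (rule ccontr)
  assume "p \<noteq> 0"
  then have "finite (range complex_of_real)"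
    using assms by (intro finite_subset[OF _ poly_roots_finite]) auto
  then show False using infinite_UNIV_char_0 finite_imageD inj_of_real by blast
qed

text \<open>Complexifying the real and the imaginary part of \<open>s\<close> makes \<open>s\<close> and its conjugate
  independent variables.\<close>

lemma conj_power_sum_coeffs_eq_0:
  fixes c :: "'a \<Rightarrow> 'a \<Rightarrow> complex" and w :: "'a \<Rightarrow> nat"
  assumes "finite S" "inj_on w S"
    and "\<And>s. (\<Sum>\<alpha>\<in>S. \<Sum>\<beta>\<in>S. c \<alpha> \<beta> * s ^ w \<alpha> * cnj s ^ w \<beta>) = 0" "\<alpha> \<in> S" "\<beta> \<in> S"
  shows "c \<alpha> \<beta> = 0"
proof -
  define P where "P u t = (\<Sum>\<alpha>\<in>S. \<Sum>\<beta>\<in>S. c \<alpha> \<beta> * u ^ w \<alpha> * t ^ w \<beta>)" for u t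
  have real: "P (complex_of_real x + \<i> * complex_of_real y) (complex_of_real x - \<i> * complex_of_real y) = 0" for x y
    using assms(3)[of "complex_of_real x + \<i> * complex_of_real y"] by (simp add: P_def)
  have x: "P (x + \<i> * complex_of_real y) (x - \<i> * complex_of_real y) = 0" for x y
  proof -
    define p where "p = (\<Sum>\<alpha>\<in>S. \<Sum>\<beta>\<in>S. Polynomial.smult (c \<alpha> \<beta>)
      ([:\<i> * complex_of_real y, 1:] ^ w \<alpha> * [:- (\<i> * complex_of_real y), 1:] ^ w \<beta>))"
    have p: "poly p x = P (x + \<i> * complex_of_real y) (x - \<i> * complex_of_real y)" for x
      by (simp add: p_def P_def poly_sum mult.assoc add.commute)
    then have "p = 0" using real by (intro poly_eq_0_if_zero_on_reals) simp
    then show ?thesis using p[of x] by simp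
  qed
  have xy: "P (x + \<i> * y) (x - \<i> * y) = 0" for x y
  proof -
    define p where "p = (\<Sum>\<alpha>\<in>S. \<Sum>\<beta>\<in>S. Polynomial.smult (c \<alpha> \<beta>) ([:x, \<i>:] ^ w \<alpha> * [:x, - \<i>:] ^ w \<beta>))"
    have p: "poly p y = P (x + \<i> * y) (x - \<i> * y)" for y
      by (simp add: p_def P_def poly_sum mult.assoc mult.commute[of y])
    then have "p = 0" using x by (intro poly_eq_0_if_zero_on_reals) simp
    then show ?thesis using p[of y] by simp
  qed
  have "P u t = 0" for u t
  proof -
    have "(u + t) / 2 + \<i> * ((u - t) / (2 * \<i>)) = u" "(u + t) / 2 - \<i> * ((u - t) / (2 * \<i>)) = t"
      by (simp_all add: field_simps)
    then show ?thesis using xy[of "(u + t) / 2" "(u - t) / (2 * \<i>)"] by simp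
  qed
  moreover have "(\<Sum>\<alpha>\<in>S. (\<Sum>\<beta>\<in>S. c \<alpha> \<beta> * t ^ w \<beta>) * u ^ w \<alpha>) = P u t" for u t
    unfolding P_def sum_distrib_right by (intro sum.cong refl) (simp add: mult_ac)
  ultimately have "(\<Sum>\<alpha>\<in>S. (\<Sum>\<beta>\<in>S. c \<alpha> \<beta> * t ^ w \<beta>) * u ^ w \<alpha>) = 0" for u t by simp
  then have "(\<Sum>\<beta>\<in>S. c \<alpha> \<beta> * t ^ w \<beta>) = 0" for t
    using power_sum_coeffs_eq_0[OF assms(1,2), of "\<lambda>\<alpha>. \<Sum>\<beta>\<in>S. c \<alpha> \<beta> * t ^ w \<beta>"] assms(4) by blast
  then show ?thesis using power_sum_coeffs_eq_0[OF assms(1,2), of "c \<alpha>"] assms(5) by blast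
qed

text \<open>Numbers below \<open>B\<close> are read as base-\<open>B\<close> digits and
  \<open>v\<close> consists of powers of \<open>B\<close>; reduction modulo \<open>B\<close>
  recovers one digit at a time.\<close>

lemma additive_weight_exists:
  assumes "finite I"
  shows "\<exists>v :: 'a \<Rightarrow> nat. \<forall>\<alpha> \<beta> :: 'a \<Rightarrow> nat. (\<forall>i\<in>I. \<alpha> i < B \<and> \<beta> i < B) \<longrightarrow>
    (\<Sum>i\<in>I. v i * \<alpha> i) = (\<Sum>i\<in>I. v i * \<beta> i) \<longrightarrow> (\<forall>i\<in>I. \<alpha> i = \<beta> i)"
  using assms
proof (induction I rule: finite_induct)
  case (insert j I)
  then obtain v :: "'a \<Rightarrow> nat" where v: "\<And>\<alpha> \<beta> :: 'a \<Rightarrow> nat. (\<forall>i\<in>I. \<alpha> i < B \<and> \<beta> i < B) \<Longrightarrow>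
    (\<Sum>i\<in>I. v i * \<alpha> i) = (\<Sum>i\<in>I. v i * \<beta> i) \<Longrightarrow> (\<forall>i\<in>I. \<alpha> i = \<beta> i)" by blast
  let ?v = "\<lambda>i. if i = j then 1 else B * v i"
  have eq: "(\<Sum>i\<in>insert j I. ?v i * \<alpha> i) = \<alpha> j + B * (\<Sum>i\<in>I. v i * \<alpha> i)" for \<alpha> :: "'a \<Rightarrow> nat"
  proof -
    have "(\<Sum>i\<in>I. ?v i * \<alpha> i) = (\<Sum>i\<in>I. B * (v i * \<alpha> i))"
      using insert.hyps by (intro sum.cong) auto
    then show ?thesis using insert.hyps by (simp add: sum_distrib_left)
  qed
  show ?case
  proof (intro exI[of _ ?v] allI impI)
    fix \<alpha> \<beta> :: "'a \<Rightarrow> nat"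
    assume small: "\<forall>i\<in>insert j I. \<alpha> i < B \<and> \<beta> i < B"
      and "(\<Sum>i\<in>insert j I. ?v i * \<alpha> i) = (\<Sum>i\<in>insert j I. ?v i * \<beta> i)"
    from this(2) have *: "\<alpha> j + B * (\<Sum>i\<in>I. v i * \<alpha> i) = \<beta> j + B * (\<Sum>i\<in>I. v i * \<beta> i)" unfolding eq .
    then have "(\<alpha> j + B * (\<Sum>i\<in>I. v i * \<alpha> i)) mod B = (\<beta> j + B * (\<Sum>i\<in>I. v i * \<beta> i)) mod B" by simp
    then have "\<alpha> j = \<beta> j" using small by simp
    moreover have "B > 0" using small by (cases B) auto
    ultimately have "(\<Sum>i\<in>I. v i * \<alpha> i) = (\<Sum>i\<in>I. v i * \<beta> i)" using * by simp
    then have "\<forall>i\<in>I. \<alpha> i = \<beta> i" using v[of \<alpha> \<beta>] small by blast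
    then show "\<forall>i\<in>insert j I. \<alpha> i = \<beta> i" using \<open>\<alpha> j = \<beta> j\<close> by simp
  qed
qed simp

text \<open>An additive weight that separates the monomials at hand replaces a monomial order.\<close>

definition weight :: "('n::finite \<Rightarrow> nat) \<Rightarrow> ('n \<Rightarrow>\<^sub>0 nat) \<Rightarrow> nat" where
  "weight v \<alpha> = (\<Sum>i\<in>UNIV. v i * Poly_Mapping.lookup \<alpha> i)"

lemma weight_add: "weight v (\<alpha> + \<beta>) = weight v \<alpha> + weight v \<beta>"
  by (simp add: weight_def lookup_add algebra_simps sum.distrib)

lemma injective_weight_exists:
  fixes S :: "('n::finite \<Rightarrow>\<^sub>0 nat) set"
  assumes "finite S"
  obtains v where "inj_on (weight v) S"
proof -
  define B where "B = Suc (Max (insert 0 (mdeg ` S)))"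
  have B: "Poly_Mapping.lookup \<alpha> i < B" if "\<alpha> \<in> S" for \<alpha> i
  proof -
    have "Poly_Mapping.lookup \<alpha> i \<le> mdeg \<alpha>" unfolding mdeg_def by (intro member_le_sum) auto
    also have "mdeg \<alpha> < B" using assms that by (auto simp: B_def less_Suc_eq_le)
    finally show ?thesis .
  qed
  obtain v :: "'n \<Rightarrow> nat" where v: "\<And>\<alpha> \<beta> :: 'n \<Rightarrow> nat. (\<forall>i. \<alpha> i < B \<and> \<beta> i < B) \<Longrightarrow>
    (\<Sum>i\<in>UNIV. v i * \<alpha> i) = (\<Sum>i\<in>UNIV. v i * \<beta> i) \<Longrightarrow> (\<forall>i. \<alpha> i = \<beta> i)"
    using additive_weight_exists[of "UNIV :: 'n set" B] by auto
  have "inj_on (weight v) S"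
    by (rule inj_onI) (use v B in \<open>auto simp: weight_def intro!: poly_mapping_eqI\<close>)
  then show ?thesis using that by blast
qed

text \<open>On the curve with coordinates \<open>s ^ v i\<close> the monomials in \<open>S\<close>
  become powers of \<open>s\<close> with distinct exponents, which reduces the claim to one complex
  variable.\<close>

lemma hermitian_form_coeffs_eq_0:
  fixes S :: "('n::finite \<Rightarrow>\<^sub>0 nat) set"
  assumes "finite S"
    and "\<And>z :: complex ^ 'n. (\<Sum>\<alpha>\<in>S. \<Sum>\<beta>\<in>S. c \<alpha> \<beta> * mono_val z \<alpha> * cnj (mono_val z \<beta>)) = 0"
    and "\<alpha> \<in> S" "\<beta> \<in> S"
  shows "c \<alpha> \<beta> = 0"
proof -
  obtain v where v: "inj_on (weight v) S" using injective_weight_exists[OF assms(1)] .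
  have "(\<Sum>\<alpha>\<in>S. \<Sum>\<beta>\<in>S. c \<alpha> \<beta> * s ^ weight v \<alpha> * cnj s ^ weight v \<beta>) = 0" for s
  proof -
    have "mono_val (\<chi> i. s ^ v i) \<alpha> = s ^ weight v \<alpha>" for \<alpha>
      by (simp add: mono_val_def weight_def power_sum power_mult)
    then show ?thesis using assms(2)[of "\<chi> i. s ^ v i"] by simp
  qed
  from conj_power_sum_coeffs_eq_0[OF assms(1) v this assms(3,4)] show ?thesis .
qed

section \<open>Hermitian forms as weighted sums of squared norms\<close>

lemma index_mult_mat_sum:
  assumes "A \<in> carrier_mat n m" "B \<in> carrier_mat m k" "i < n" "j < k"
  shows "(A * B) $$ (i, j) = (\<Sum>l<m. A $$ (i, l) * B $$ (l, j))"
  using assms by (simp add: scalar_prod_def atLeast0LessThan)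

lemma proots_linear_factors: "proots (\<Prod>a\<leftarrow>as. [:- a, 1:]) = mset (as :: complex list)"
proof -
  have "proots (\<Prod>p\<leftarrow>map (\<lambda>a. [:- a, 1:]) as. p) = (\<Sum>p\<leftarrow>map (\<lambda>a. [:- a, 1:]) as. proots p)"
    by (rule proots_prod_list) auto
  also have "\<dots> = mset as" by (induction as) auto
  finally show ?thesis by simp
qed

lemma bi_eval_homogeneous:
  fixes M :: "'n::finite bipoly" and z :: "complex ^ 'n"
  assumes "bihomogeneous d M"
  shows "bi_eval M z = (\<Sum>\<alpha> | mdeg \<alpha> = d. \<Sum>\<beta> | mdeg \<beta> = d.
    Poly_Mapping.lookup M (\<alpha>, \<beta>) * mono_val z \<alpha> * cnj (mono_val z \<beta>))"
proof -
  have "bi_eval M z = (\<Sum>(\<alpha>, \<beta>)\<in>{\<alpha>. mdeg \<alpha> = d} \<times> {\<alpha>. mdeg \<alpha> = d}.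
    Poly_Mapping.lookup M (\<alpha>, \<beta>) * mono_val z \<alpha> * cnj (mono_val z \<beta>))"
    unfolding bi_eval_def using assms
    by (intro sum.mono_neutral_cong_left)
      (auto simp: finite_mdeg bihomogeneous_def in_keys_iff)
  then show ?thesis by (simp add: sum.cartesian_product)
qed

text \<open>Reality is a condition on values; it passes to coefficients because the form minus its
  conjugate vanishes at every point.\<close>

lemma hermitian_poly_coeffs:
  fixes M :: "'n::finite bipoly"
  assumes "bihomogeneous d M" "hermitian_poly M"
  shows "Poly_Mapping.lookup M (\<alpha>, \<beta>) = cnj (Poly_Mapping.lookup M (\<beta>, \<alpha>))"
proof -
  let ?D = "{\<alpha> :: 'n \<Rightarrow>\<^sub>0 nat. mdeg \<alpha> = d}"
  define c where "c \<alpha> \<beta> = Poly_Mapping.lookup M (\<alpha>, \<beta>) - cnj (Poly_Mapping.lookup M (\<beta>, \<alpha>))" for \<alpha> \<beta>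
  have "(\<Sum>\<alpha>\<in>?D. \<Sum>\<beta>\<in>?D. c \<alpha> \<beta> * mono_val z \<alpha> * cnj (mono_val z \<beta>)) = bi_eval M z - cnj (bi_eval M z)" for z
  proof -
    have "cnj (bi_eval M z) = (\<Sum>\<beta>\<in>?D. \<Sum>\<alpha>\<in>?D. cnj (Poly_Mapping.lookup M (\<beta>, \<alpha>)) * mono_val z \<alpha> * cnj (mono_val z \<beta>))"
      unfolding bi_eval_homogeneous[OF assms(1)] cnj_sum by (intro sum.cong refl) (simp add: mult_ac)
    also have "\<dots> = (\<Sum>\<alpha>\<in>?D. \<Sum>\<beta>\<in>?D. cnj (Poly_Mapping.lookup M (\<beta>, \<alpha>)) * mono_val z \<alpha> * cnj (mono_val z \<beta>))"
      by (rule sum.swap)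
    finally show ?thesis
      by (simp add: bi_eval_homogeneous[OF assms(1)] c_def algebra_simps sum_subtractf)
  qed
  moreover have "bi_eval M z - cnj (bi_eval M z) = 0" for z
    using assms(2) by (auto simp: hermitian_poly_def complex_is_Real_iff complex_eq_iff)
  ultimately have zero: "(\<Sum>\<alpha>\<in>?D. \<Sum>\<beta>\<in>?D. c \<alpha> \<beta> * mono_val z \<alpha> * cnj (mono_val z \<beta>)) = 0" for z
    by simp
  have "c \<alpha> \<beta> = 0" if "\<alpha> \<in> ?D" "\<beta> \<in> ?D"
    by (rule hermitian_form_coeffs_eq_0[OF finite_mdeg zero that])
  moreover have "c \<alpha> \<beta> = 0" if "\<not> (\<alpha> \<in> ?D \<and> \<beta> \<in> ?D)"
  proof -
    have "(\<alpha>, \<beta>) \<notin> Poly_Mapping.keys M" "(\<beta>, \<alpha>) \<notin> Poly_Mapping.keys M"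
      using that assms(1) by (auto simp: bihomogeneous_def)
    then show ?thesis by (simp add: c_def in_keys_iff)
  qed
  ultimately show ?thesis by (auto simp: c_def)
qed

text \<open>Holomorphic forms are represented by their coefficient functions from here on.\<close>

lemma hermitian_poly_diagonalization:
  fixes M :: "'n::finite bipoly"
  assumes "bihomogeneous d M" "hermitian_poly M"
  obtains u :: "nat \<Rightarrow> ('n \<Rightarrow>\<^sub>0 nat) \<Rightarrow> complex" and \<mu> :: "nat \<Rightarrow> real" and m :: nat where
    "\<And>k \<alpha>. mdeg \<alpha> \<noteq> d \<Longrightarrow> u k \<alpha> = 0"
    "\<And>\<alpha> \<beta>. Poly_Mapping.lookup M (\<alpha>, \<beta>) = (\<Sum>k<m. complex_of_real (\<mu> k) * u k \<alpha> * cnj (u k \<beta>))"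
    "\<And>k l. k < m \<Longrightarrow> l < m \<Longrightarrow> (\<Sum>\<alpha> | mdeg \<alpha> = d. u k \<alpha> * cnj (u l \<alpha>)) = (if k = l then 1 else 0)"
    "poly_signature d M = (card {k. k < m \<and> \<mu> k > 0}, card {k. k < m \<and> \<mu> k < 0})"
proof -
  define Z where "Z = (monomials d :: ('n \<Rightarrow>\<^sub>0 nat) list)"
  define m where "m = length Z"
  define A where "A = coeff_matrix d M"
  let ?D = "{\<alpha> :: 'n \<Rightarrow>\<^sub>0 nat. mdeg \<alpha> = d}"
  have bij: "bij_betw ((!) Z) {..<m} ?D"
    using bij_betw_nth[OF monomials(1) refl refl, of d] monomials(2) unfolding Z_def m_def by metis
  have A: "A \<in> carrier_mat m m" by (simp add: A_def coeff_matrix_def Let_def m_def Z_def)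
  have A_index: "A $$ (i, j) = Poly_Mapping.lookup M (Z ! j, Z ! i)" if "i < m" "j < m" for i j
    using that by (simp add: A_def coeff_matrix_def Let_def m_def Z_def)
  have adj: "mat_adjoint A = A"
    using A hermitian_poly_coeffs[OF assms]
    by (intro eq_matI) (auto simp: mat_adjoint_eq A_index simp flip: hermitian_poly_coeffs[OF assms])
  obtain P ds where P: "P \<in> carrier_mat m m" "mat_adjoint P * P = 1\<^sub>m m" "P * mat_adjoint P = 1\<^sub>m m"
    "length ds = m"
    and APD: "A = P * mat m m (\<lambda>(i, j). if i = j then complex_of_real (ds ! i) else 0) * mat_adjoint P"
    by (rule hermitian_spectral_decomposition[OF A adj])
  define Dg where "Dg = mat m m (\<lambda>(i, j). if i = j then complex_of_real (ds ! i) else 0)"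
  have Dg: "Dg \<in> carrier_mat m m" by (simp add: Dg_def)
  have Pa: "mat_adjoint P \<in> carrier_mat m m" using P by (simp add: mat_adjoint_eq)
  define idx where "idx = the_inv_into {..<m} ((!) Z)"
  have idx: "idx (Z ! j) = j" if "j < m" for j
    unfolding idx_def using bij that by (intro the_inv_into_f_f) (auto simp: bij_betw_def)
  have idx_D: "idx \<alpha> < m" "Z ! idx \<alpha> = \<alpha>" if "mdeg \<alpha> = d" for \<alpha>
  proof -
    obtain j where "j < m" "\<alpha> = Z ! j" using bij \<open>mdeg \<alpha> = d\<close> unfolding bij_betw_def by blast
    then show "idx \<alpha> < m" "Z ! idx \<alpha> = \<alpha>" using idx by auto
  qed
  \<comment> \<open>The entries of \<open>P\<close> are conjugated because the row index of the
    coefficient matrix belongs to the conjugated monomial.\<close>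
  define u where "u k \<alpha> = (if mdeg \<alpha> = d then cnj (P $$ (idx \<alpha>, k)) else 0)" for k \<alpha>
  have deg: "mdeg (Z ! j) = d" if "j < m" for j using bij that by (auto simp: bij_betw_def)
  show ?thesis
  proof (rule that[of u "\<lambda>k. ds ! k" m])
    fix \<alpha> \<beta>
    show "Poly_Mapping.lookup M (\<alpha>, \<beta>) = (\<Sum>k<m. complex_of_real (ds ! k) * u k \<alpha> * cnj (u k \<beta>))"
    proof (cases "mdeg \<alpha> = d \<and> mdeg \<beta> = d")
      case True
      then have i: "idx \<alpha> < m" "idx \<beta> < m" using idx_D by auto
      have PD: "(P * Dg) $$ (idx \<beta>, k) = P $$ (idx \<beta>, k) * complex_of_real (ds ! k)" if "k < m" for k
      proof -
        have "(P * Dg) $$ (idx \<beta>, k) = (\<Sum>j<m. P $$ (idx \<beta>, j) * Dg $$ (j, k))"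
          by (rule index_mult_mat_sum[OF P(1) Dg i(2) that])
        also have "\<dots> = (\<Sum>j<m. if j = k then P $$ (idx \<beta>, k) * complex_of_real (ds ! k) else 0)"
          using that by (intro sum.cong) (auto simp: Dg_def)
        finally show ?thesis using that by simp
      qed
      have "Poly_Mapping.lookup M (\<alpha>, \<beta>) = A $$ (idx \<beta>, idx \<alpha>)"
        using A_index[OF i(2) i(1)] idx_D True by simp
      also have "\<dots> = (\<Sum>k<m. (P * Dg) $$ (idx \<beta>, k) * mat_adjoint P $$ (k, idx \<alpha>))"
        unfolding APD Dg_def[symmetric] using P(1) Dg Pa i
        by (intro index_mult_mat_sum[OF mult_carrier_mat]) auto
      also have "\<dots> = (\<Sum>k<m. complex_of_real (ds ! k) * u k \<alpha> * cnj (u k \<beta>))"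
        using True i P by (intro sum.cong refl) (simp add: PD u_def mat_adjoint_eq mult_ac)
      finally show ?thesis .
    next
      case False
      then have "(\<alpha>, \<beta>) \<notin> Poly_Mapping.keys M" using assms(1) by (auto simp: bihomogeneous_def)
      then show ?thesis using False by (auto simp: in_keys_iff u_def)
    qed
  next
    fix k l assume kl: "k < m" "l < m"
    have "(\<Sum>\<alpha>\<in>?D. u k \<alpha> * cnj (u l \<alpha>)) = (\<Sum>j<m. u k (Z ! j) * cnj (u l (Z ! j)))"
      by (rule sum.reindex_bij_betw[OF bij, symmetric])
    also have "\<dots> = (\<Sum>j<m. cnj (P $$ (j, k)) * P $$ (j, l))"
      using deg idx by (intro sum.cong) (auto simp: u_def)
    also have "\<dots> = (mat_adjoint P * P) $$ (k, l)"
      unfolding index_mult_mat_sum[OF Pa P(1) kl] using P(1) kl by (simp add: mat_adjoint_eq)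
    finally show "(\<Sum>\<alpha>\<in>?D. u k \<alpha> * cnj (u l \<alpha>)) = (if k = l then 1 else 0)"
      using P(2) kl by simp
  next
    \<comment> \<open>Similarity to a real diagonal matrix identifies the roots of the
      characteristic polynomial, with multiplicity, with the list \<open>ds\<close>.\<close>
    have "similar_mat_wit A Dg P (mat_adjoint P)"
      by (rule similar_mat_witI[of _ _ m]) (use P A Dg Pa APD Dg_def in auto)
    then have "char_poly A = char_poly Dg" by (intro char_poly_similar) (auto simp: similar_mat_def)
    also have "\<dots> = (\<Prod>a\<leftarrow>diag_mat Dg. [:- a, 1:])"
      using Dg by (intro char_poly_upper_triangular[of _ m]) (auto simp: Dg_def upper_triangular_def)
    also have "diag_mat Dg = map complex_of_real ds"
      using P(4) by (intro nth_equalityI) (auto simp: diag_mat_def Dg_def)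
    finally have roots: "proots (char_poly A) = mset (map complex_of_real ds)"
      by (simp only: proots_linear_factors)
    have count: "size {#x \<in># mset (map complex_of_real ds). x \<in> \<real> \<and> Q (Re x)#} = card {k. k < m \<and> Q (ds ! k)}" for Q
    proof -
      have "size {#x \<in># mset (map complex_of_real ds). x \<in> \<real> \<and> Q (Re x)#} = length (filter Q ds)"
        by (simp only: mset_filter[symmetric] size_mset) (simp add: filter_map o_def)
      then show ?thesis using P(4) by (simp add: length_filter_conv_card)
    qed
    show "poly_signature d M = (card {k. k < m \<and> ds ! k > 0}, card {k. k < m \<and> ds ! k < 0})"
      using count[of "\<lambda>x. x > 0"] count[of "\<lambda>x. x < 0"]
      by (simp add: poly_signature_def num_pos_eigenvalues_def num_neg_eigenvalues_def roots flip: A_def)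
  qed (simp add: u_def)
qed

section \<open>Monomials and powers of the norm\<close>

lemma mono_val_add: "mono_val z (\<alpha> + \<beta>) = mono_val z \<alpha> * mono_val z \<beta>"
  by (simp add: mono_val_def lookup_add power_add prod.distrib)

lemma mdeg_add: "mdeg (\<alpha> + \<beta>) = mdeg \<alpha> + mdeg \<beta>"
  by (simp add: mdeg_def lookup_add sum.distrib)

lemma mdeg_single: "mdeg (Poly_Mapping.single i k) = k"
  by (simp add: mdeg_def lookup_single when_def)

lemma mono_val_single: "mono_val z (Poly_Mapping.single i k) = vec_nth z i ^ k"
proof -
  have "mono_val z (Poly_Mapping.single i k) = (\<Prod>j\<in>UNIV. if j = i then vec_nth z i ^ k else 1)"
    unfolding mono_val_def by (intro prod.cong) (auto simp: lookup_single when_def)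
  then show ?thesis by simp
qed

lemma mdeg_Suc_split:
  assumes "mdeg \<alpha> = Suc l"
  obtains i \<beta> where "\<alpha> = \<beta> + Poly_Mapping.single i 1" "mdeg \<beta> = l"
proof -
  obtain i where i: "Poly_Mapping.lookup \<alpha> i > 0"
    using assms unfolding mdeg_def by (metis gr0I nat.distinct(1) sum.neutral)
  have "\<alpha> = (\<alpha> - Poly_Mapping.single i 1) + Poly_Mapping.single i 1"
    using i by (intro poly_mapping_eqI) (auto simp: lookup_add lookup_minus lookup_single when_def)
  moreover from arg_cong[OF this, of mdeg] have "mdeg (\<alpha> - Poly_Mapping.single i 1) = l"
    using assms by (simp add: mdeg_add mdeg_single)
  ultimately show ?thesis using that by blast
qed

text \<open>The coefficients are the multinomial ones, kept abstract; their positivity ensures that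
  multiplying by the norm power preserves the sign of each eigenvalue.\<close>

lemma norm_power_expansion:
  "\<exists>c. (\<forall>\<gamma>. mdeg \<gamma> = l \<longrightarrow> c \<gamma> > 0) \<and>
    (\<forall>z :: complex ^ 'n::finite. norm z ^ (2 * l) = (\<Sum>\<gamma> | mdeg \<gamma> = l. c \<gamma> * (cmod (mono_val z \<gamma>))\<^sup>2))"
proof (induction l)
  case 0
  have "{\<gamma> :: 'n \<Rightarrow>\<^sub>0 nat. mdeg \<gamma> = 0} = {0}"
    by (auto simp: mdeg_def intro!: poly_mapping_eqI)
  then show ?case by (intro exI[of _ "\<lambda>_. 1"]) (simp add: mono_val_def)
next
  case (Suc l)
  let ?G = "\<lambda>l. {\<gamma> :: 'n \<Rightarrow>\<^sub>0 nat. mdeg \<gamma> = l}"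
  let ?X = "?G l \<times> (UNIV :: 'n set)"
  let ?f = "\<lambda>(\<gamma>, i). \<gamma> + Poly_Mapping.single i 1"
  obtain c where c: "\<And>\<gamma>. mdeg \<gamma> = l \<Longrightarrow> c \<gamma> > 0"
    "\<And>z :: complex ^ 'n. norm z ^ (2 * l) = (\<Sum>\<gamma>\<in>?G l. c \<gamma> * (cmod (mono_val z \<gamma>))\<^sup>2)" using Suc by auto
  \<comment> \<open>A monomial of degree \<open>Suc l\<close> collects one term for each way of
    splitting off a variable; there is at least one, hence positivity.\<close>
  define c' where "c' \<gamma> = (\<Sum>x\<in>{x \<in> ?X. ?f x = \<gamma>}. c (fst x))" for \<gamma>
  have finX: "finite ?X" by (intro finite_cartesian_product finite_mdeg finite)
  show ?case
  proof (intro exI[of _ c'] conjI allI impI)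
    fix \<gamma> :: "'n \<Rightarrow>\<^sub>0 nat" assume "mdeg \<gamma> = Suc l"
    then obtain i \<beta> where "\<gamma> = \<beta> + Poly_Mapping.single i 1" "mdeg \<beta> = l" by (rule mdeg_Suc_split)
    then have "{x \<in> ?X. ?f x = \<gamma>} \<noteq> {}" by auto
    then show "c' \<gamma> > 0" unfolding c'_def
      using finX c(1) by (intro sum_pos) auto
  next
    fix z :: "complex ^ 'n"
    have "(norm z)\<^sup>2 = (\<Sum>i\<in>UNIV. (cmod (vec_nth z i))\<^sup>2)"
      by (simp add: norm_vec_def L2_set_def sum_nonneg)
    moreover have "norm z ^ (2 * Suc l) = norm z ^ (2 * l) * (norm z)\<^sup>2"
      by (simp flip: power_add)
    ultimately have "norm z ^ (2 * Suc l) = (\<Sum>\<gamma>\<in>?G l. \<Sum>i\<in>UNIV. c \<gamma> * (cmod (mono_val z \<gamma>))\<^sup>2 * (cmod (vec_nth z i))\<^sup>2)"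
      by (simp only: c(2) sum_product)
    also have "\<dots> = (\<Sum>x\<in>?X. c (fst x) * (cmod (mono_val z (?f x)))\<^sup>2)"
      by (simp add: sum.cartesian_product case_prod_unfold mono_val_add mono_val_single norm_mult power_mult_distrib mult.assoc)
    also have "\<dots> = (\<Sum>\<gamma>\<in>?G (Suc l). \<Sum>x\<in>{x \<in> ?X. ?f x = \<gamma>}. c (fst x) * (cmod (mono_val z (?f x)))\<^sup>2)"
      using finX finite_mdeg by (intro sum.group[symmetric]) (auto simp: mdeg_add mdeg_single)
    also have "\<dots> = (\<Sum>\<gamma>\<in>?G (Suc l). c' \<gamma> * (cmod (mono_val z \<gamma>))\<^sup>2)"
      unfolding c'_def sum_distrib_right by (intro sum.cong) auto
    finally show "norm z ^ (2 * Suc l) = (\<Sum>\<gamma>\<in>?G (Suc l). c' \<gamma> * (cmod (mono_val z \<gamma>))\<^sup>2)" .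
  qed
qed

lemma card_mdeg_le: "card {\<gamma> :: 'n::finite \<Rightarrow>\<^sub>0 nat. mdeg \<gamma> = l} \<le> (CARD('n) - 1 + l) choose l"
proof -
  obtain xs :: "'n list" where xs: "set xs = UNIV" "distinct xs"
    using finite_distinct_list[of "UNIV :: 'n set"] by auto
  have len: "length xs = CARD('n)" using xs distinct_card by metis
  let ?f = "\<lambda>\<gamma> :: 'n \<Rightarrow>\<^sub>0 nat. map (Poly_Mapping.lookup \<gamma>) xs"
  let ?B = "{ns :: nat list. length ns = CARD('n) \<and> sum_list ns = l}"
  have "card {\<gamma> :: 'n \<Rightarrow>\<^sub>0 nat. mdeg \<gamma> = l} \<le> card ?B"
  proof (rule card_inj_on_le)
    show "inj_on ?f {\<gamma>. mdeg \<gamma> = l}" using xs by (auto simp: inj_on_def intro!: poly_mapping_eqI)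
    show "?f ` {\<gamma>. mdeg \<gamma> = l} \<subseteq> ?B"
      using xs len by (auto simp: mdeg_def sum_list_distinct_conv_sum_set)
    show "finite ?B"
    proof (rule finite_subset)
      show "?B \<subseteq> {ns. set ns \<subseteq> {..l} \<and> length ns = CARD('n)}" using member_le_sum_list by fastforce
    qed (rule finite_lists_length_eq, simp)
  qed
  also have "card ?B = (CARD('n) - 1 + l) choose l"
  proof -
    have "l + CARD('n) - 1 = CARD('n) - 1 + l" using zero_less_card_finite[where 'a = 'n] by linarith
    then show ?thesis by (simp add: card_length_sum_list)
  qed
  finally show ?thesis .
qed

section \<open>Multiplication by monomials\<close>

text \<open>Multiplication by the monomial with exponent \<gamma>. The divisibility test is there
  because subtraction of exponents truncates at 0.\<close>

definition shift :: "('n \<Rightarrow>\<^sub>0 nat) \<Rightarrow> (('n \<Rightarrow>\<^sub>0 nat) \<Rightarrow> complex) \<Rightarrow> ('n \<Rightarrow>\<^sub>0 nat) \<Rightarrow> complex" where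
  "shift \<gamma> f \<alpha> = (if \<exists>\<beta>. \<alpha> = \<beta> + \<gamma> then f (\<alpha> - \<gamma>) else 0)"

lemma shift_add [simp]: "shift \<gamma> f (\<beta> + \<gamma>) = f \<beta>"
  by (auto simp: shift_def)

lemma shift_nonzero:
  assumes "shift \<gamma> f \<alpha> \<noteq> 0"
  obtains \<beta> where "\<alpha> = \<beta> + \<gamma>" "f \<beta> \<noteq> 0"
  using assms by (auto simp: shift_def split: if_splits)

lemma sum_shift:
  assumes "finite S" "(\<lambda>\<beta>. \<beta> + \<gamma>) ` D \<subseteq> S" "\<And>\<beta>. \<beta> \<notin> D \<Longrightarrow> f \<beta> = 0"
  shows "(\<Sum>\<alpha>\<in>S. shift \<gamma> f \<alpha> * F \<alpha>) = (\<Sum>\<beta>\<in>D. f \<beta> * F (\<beta> + \<gamma>))"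
proof -
  have "inj_on (\<lambda>\<beta>. \<beta> + \<gamma>) D" by (auto simp: inj_on_def)
  then have "(\<Sum>\<beta>\<in>D. f \<beta> * F (\<beta> + \<gamma>)) = (\<Sum>\<alpha>\<in>(\<lambda>\<beta>. \<beta> + \<gamma>) ` D. shift \<gamma> f \<alpha> * F \<alpha>)"
    by (simp add: sum.reindex)
  also have "\<dots> = (\<Sum>\<alpha>\<in>S. shift \<gamma> f \<alpha> * F \<alpha>)"
  proof (rule sum.mono_neutral_left[OF assms(1,2)], rule ballI)
    fix \<alpha> assume "\<alpha> \<in> S - (\<lambda>\<beta>. \<beta> + \<gamma>) ` D"
    then have "shift \<gamma> f \<alpha> = 0" using assms(3) by (metis DiffD2 image_eqI shift_nonzero)
    then show "shift \<gamma> f \<alpha> * F \<alpha> = 0" by simp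
  qed
  finally show ?thesis ..
qed

lemma shift_in_span:
  assumes "f \<in> cfun.span U" "\<And>u. u \<in> U \<Longrightarrow> shift \<gamma> u \<in> cfun.span T"
  shows "shift \<gamma> f \<in> cfun.span T"
proof -
  have add: "shift \<gamma> (f + g) = shift \<gamma> f + shift \<gamma> g" for f g by (auto simp: shift_def fun_eq_iff)
  have scale: "shift \<gamma> (\<lambda>x. c * f x) = (\<lambda>x. c * shift \<gamma> f x)" for c f by (auto simp: shift_def fun_eq_iff)
  have zero: "shift \<gamma> 0 = 0" by (auto simp: shift_def fun_eq_iff)
  have "cfun.subspace {f. shift \<gamma> f \<in> cfun.span T}"
    unfolding cfun.subspace_def mem_Collect_eq add scale zero
    using cfun.span_zero cfun.span_add cfun.span_scale by blast
  then have "cfun.span U \<subseteq> {f. shift \<gamma> f \<in> cfun.span T}"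
    using assms(2) by (intro cfun.span_minimal) auto
  then show ?thesis using assms(1) by auto
qed

text \<open>The weight is additive, so the whole support is raised by the same amount
  \<open>weight v \<gamma>\<close>.\<close>

lemma leading_shift:
  assumes "leading (weight v) f \<alpha>"
  shows "leading (weight v) (shift \<gamma> f) (\<alpha> + \<gamma>)"
proof -
  have "weight v \<beta> \<le> weight v (\<alpha> + \<gamma>)" if \<beta>: "shift \<gamma> f \<beta> \<noteq> 0" for \<beta>
    using assms by (rule_tac shift_nonzero[OF \<beta>]) (auto simp: leading_def weight_add)
  then show ?thesis using assms by (auto simp: leading_def)
qed

section \<open>Comparison of quadratic forms\<close>

text \<open>Stated for an arbitrary \<open>F\<close>, so that one identity serves both the monomial
  values at a point and a functional.\<close>

lemma gram_form:
  "(\<Sum>\<alpha>\<in>S. \<Sum>\<beta>\<in>S. (\<Sum>x\<in>X. complex_of_real (\<mu> x) * g x \<alpha> * cnj (g x \<beta>)) * F \<alpha> * cnj (F \<beta>)) =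
    complex_of_real (\<Sum>x\<in>X. \<mu> x * (cmod (\<Sum>\<alpha>\<in>S. g x \<alpha> * F \<alpha>))\<^sup>2)"
proof -
  have "complex_of_real (\<Sum>x\<in>X. \<mu> x * (cmod (\<Sum>\<alpha>\<in>S. g x \<alpha> * F \<alpha>))\<^sup>2) =
    (\<Sum>x\<in>X. complex_of_real (\<mu> x) * ((\<Sum>\<alpha>\<in>S. g x \<alpha> * F \<alpha>) * cnj (\<Sum>\<alpha>\<in>S. g x \<alpha> * F \<alpha>)))"
    by (simp add: complex_norm_square del: of_real_power)
  also have "\<dots> = (\<Sum>x\<in>X. \<Sum>\<alpha>\<in>S. \<Sum>\<beta>\<in>S. complex_of_real (\<mu> x) * (g x \<alpha> * F \<alpha> * cnj (g x \<beta> * F \<beta>)))"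
    by (simp only: cnj_sum sum_product) (simp only: sum_distrib_left)
  also have "\<dots> = (\<Sum>\<alpha>\<in>S. \<Sum>\<beta>\<in>S. \<Sum>x\<in>X. complex_of_real (\<mu> x) * (g x \<alpha> * F \<alpha> * cnj (g x \<beta> * F \<beta>)))"
    by (subst sum.swap) (intro sum.cong refl sum.swap)
  also have "\<dots> = (\<Sum>\<alpha>\<in>S. \<Sum>\<beta>\<in>S. (\<Sum>x\<in>X. complex_of_real (\<mu> x) * g x \<alpha> * cnj (g x \<beta>)) * F \<alpha> * cnj (F \<beta>))"
    unfolding sum_distrib_right by (intro sum.cong refl) (simp add: mult_ac)
  finally show ?thesis ..
qed

text \<open>The coefficient matrices of the two sides agree, so they define the same quadratic form on
  functionals; on a functional killing the positive terms this form is both \<open>\<le> 0\<close> and \<open>\<ge> 0\<close>.\<close>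

lemma sum_of_squares_annihilator:
  fixes S :: "('n::finite \<Rightarrow>\<^sub>0 nat) set" and \<mu> :: "'x \<Rightarrow> real"
  assumes "finite S" "finite X"
    and eq: "\<And>z :: complex ^ 'n. (\<Sum>x\<in>X. \<mu> x * (cmod (\<Sum>\<alpha>\<in>S. g x \<alpha> * mono_val z \<alpha>))\<^sup>2) =
      (\<Sum>i<R. (cmod (\<Sum>\<alpha>\<in>S. h i \<alpha> * mono_val z \<alpha>))\<^sup>2)"
    and pos: "\<And>x. x \<in> X \<Longrightarrow> \<mu> x > 0 \<Longrightarrow> (\<Sum>\<alpha>\<in>S. g x \<alpha> * \<phi> \<alpha>) = 0"
    and x: "x \<in> X" "\<mu> x < 0"
  shows "(\<Sum>\<alpha>\<in>S. g x \<alpha> * \<phi> \<alpha>) = 0"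
proof -
  define c where "c \<alpha> \<beta> = (\<Sum>x\<in>X. complex_of_real (\<mu> x) * g x \<alpha> * cnj (g x \<beta>)) -
    (\<Sum>i<R. complex_of_real 1 * h i \<alpha> * cnj (h i \<beta>))" for \<alpha> \<beta>
  have form: "(\<Sum>\<alpha>\<in>S. \<Sum>\<beta>\<in>S. c \<alpha> \<beta> * F \<alpha> * cnj (F \<beta>)) =
    complex_of_real ((\<Sum>x\<in>X. \<mu> x * (cmod (\<Sum>\<alpha>\<in>S. g x \<alpha> * F \<alpha>))\<^sup>2) -
      (\<Sum>i<R. 1 * (cmod (\<Sum>\<alpha>\<in>S. h i \<alpha> * F \<alpha>))\<^sup>2))" for F
    unfolding of_real_diff gram_form[symmetric] c_def left_diff_distrib sum_subtractf ..
  have "(\<Sum>\<alpha>\<in>S. \<Sum>\<beta>\<in>S. c \<alpha> \<beta> * mono_val z \<alpha> * cnj (mono_val z \<beta>)) = 0" for z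
    unfolding form using eq[of z] by simp
  \<comment> \<open>The vector \<phi> may be different from the monomial vector of every point, so
    the identity is transferred to the coefficients before \<phi> is inserted.\<close>
  then have "c \<alpha> \<beta> = 0" if "\<alpha> \<in> S" "\<beta> \<in> S" for \<alpha> \<beta>
    using hermitian_form_coeffs_eq_0[OF assms(1) _ that] by blast
  then have "(\<Sum>\<alpha>\<in>S. \<Sum>\<beta>\<in>S. c \<alpha> \<beta> * \<phi> \<alpha> * cnj (\<phi> \<beta>)) = 0" by simp
  then have "(\<Sum>x\<in>X. \<mu> x * (cmod (\<Sum>\<alpha>\<in>S. g x \<alpha> * \<phi> \<alpha>))\<^sup>2) =
    (\<Sum>i<R. (cmod (\<Sum>\<alpha>\<in>S. h i \<alpha> * \<phi> \<alpha>))\<^sup>2)"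
    unfolding form by (simp only: of_real_eq_0_iff) simp
  also have "\<dots> \<ge> 0" by (intro sum_nonneg) simp
  finally have "0 \<le> (\<Sum>x\<in>X. \<mu> x * (cmod (\<Sum>\<alpha>\<in>S. g x \<alpha> * \<phi> \<alpha>))\<^sup>2)" .
  moreover have nonpos: "\<mu> x * (cmod (\<Sum>\<alpha>\<in>S. g x \<alpha> * \<phi> \<alpha>))\<^sup>2 \<le> 0" if "x \<in> X" for x
    using pos[OF that] by (cases "\<mu> x > 0") (simp_all add: mult_nonpos_nonneg)
  then have "(\<Sum>x\<in>X. \<mu> x * (cmod (\<Sum>\<alpha>\<in>S. g x \<alpha> * \<phi> \<alpha>))\<^sup>2) \<le> 0" by (rule sum_nonpos)
  ultimately have "(\<Sum>x\<in>X. - (\<mu> x * (cmod (\<Sum>\<alpha>\<in>S. g x \<alpha> * \<phi> \<alpha>))\<^sup>2)) = 0" by (simp add: sum_negf)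
  then have "\<mu> x * (cmod (\<Sum>\<alpha>\<in>S. g x \<alpha> * \<phi> \<alpha>))\<^sup>2 = 0"
    using sum_nonneg_eq_0_iff[OF assms(2), of "\<lambda>x. - (\<mu> x * (cmod (\<Sum>\<alpha>\<in>S. g x \<alpha> * \<phi> \<alpha>))\<^sup>2)"]
      nonpos x(1) by auto
  then show ?thesis using x(2) by simp
qed

lemma iterated_growth_mono: "r \<le> s \<Longrightarrow> (growth N ^^ l) r \<le> (growth N ^^ l) s"
  by (induction l) (auto intro: growth_mono)

text \<open>Macaulay's growth bound for a space \<open>U\<close> of forms of degree \<open>d\<close>: the leading monomials of
  the products contain the products of the leading monomials.\<close>

lemma iterated_growth_card_le:
  fixes U T :: "(('n::finite \<Rightarrow>\<^sub>0 nat) \<Rightarrow> complex) set"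
  assumes ind: "cfun.independent U" and deg: "\<And>u \<alpha>. u \<in> U \<Longrightarrow> mdeg \<alpha> \<noteq> d \<Longrightarrow> u \<alpha> = 0"
    and T: "finite T" "\<And>u \<gamma>. u \<in> U \<Longrightarrow> mdeg \<gamma> = l \<Longrightarrow> shift \<gamma> u \<in> cfun.span T"
  shows "(growth (CARD('n) - 1) ^^ l) (card U) \<le> card T"
proof -
  let ?D = "\<lambda>d. {\<alpha> :: 'n \<Rightarrow>\<^sub>0 nat. mdeg \<alpha> = d}"
  \<comment> \<open>One weight serves both degrees, so that leading monomials of forms and of their
    products are taken in the same order.\<close>
  have "finite (?D d \<union> ?D (d + l))" using finite_mdeg by blast
  then obtain v where v: "inj_on (weight v) (?D d \<union> ?D (d + l))" by (rule injective_weight_exists)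
  have "cfun.subspace {f. \<forall>\<alpha>. mdeg \<alpha> \<noteq> d \<longrightarrow> f \<alpha> = (0 :: complex)}"
    by (auto simp: cfun.subspace_def)
  then have "cfun.span U \<subseteq> {f. \<forall>\<alpha>. mdeg \<alpha> \<noteq> d \<longrightarrow> f \<alpha> = 0}"
    using deg by (intro cfun.span_minimal) auto
  then have supp: "\<alpha> \<in> ?D d" if "f \<in> cfun.span U" "f \<alpha> \<noteq> 0" for f \<alpha> using that by auto
  define A where "A = {\<alpha>. \<exists>f\<in>cfun.span U. leading (weight v) f \<alpha>}"
  have A: "A \<subseteq> ?D d" using supp by (auto simp: A_def leading_def)
  then have finA: "finite A" using finite_mdeg finite_subset by blast
  have "card U \<le> card A" unfolding A_def
    using inj_on_subset[OF v Un_upper1] supp by (intro card_le_leading[OF finite_mdeg _ ind]) auto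
  define L where "L = {\<alpha> + \<gamma> | \<alpha> \<gamma>. \<alpha> \<in> A \<and> mdeg \<gamma> = l}"
  have L: "L \<subseteq> ?D (d + l)" using A by (auto simp: L_def mdeg_add)
  let ?lk = "Poly_Mapping.lookup :: ('n \<Rightarrow>\<^sub>0 nat) \<Rightarrow> 'n \<Rightarrow> nat"
  have inj: "inj_on ?lk X" for X by (auto simp: inj_on_def intro: poly_mapping_eqI)
  have "(growth (CARD('n) - 1) ^^ l) (card U) \<le> (growth (CARD('n) - 1) ^^ l) (card (?lk ` A))"
    unfolding card_image[OF inj] by (rule iterated_growth_mono) fact
  also have "\<dots> \<le> card {\<lambda>i. \<alpha> i + \<gamma> i | \<alpha> \<gamma>. \<alpha> \<in> ?lk ` A \<and> sum \<gamma> UNIV = l}"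
    using finA A by (intro card_iterated_multiples_ge[of _ d]) (auto simp: mdeg_def)
  also have "{\<lambda>i. \<alpha> i + \<gamma> i | \<alpha> \<gamma>. \<alpha> \<in> ?lk ` A \<and> sum \<gamma> UNIV = l} = ?lk ` L"
  proof (intro equalityI subsetI)
    fix \<delta> assume "\<delta> \<in> {\<lambda>i. \<alpha> i + \<gamma> i | \<alpha> \<gamma>. \<alpha> \<in> ?lk ` A \<and> sum \<gamma> UNIV = l}"
    then obtain \<alpha> \<gamma> where *: "\<alpha> \<in> A" "sum \<gamma> UNIV = l" "\<delta> = (\<lambda>i. ?lk \<alpha> i + \<gamma> i)" by auto
    have lk: "?lk (Abs_poly_mapping \<gamma>) = \<gamma>" by simp
    then have "mdeg (Abs_poly_mapping \<gamma>) = l" "\<delta> = ?lk (\<alpha> + Abs_poly_mapping \<gamma>)"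
      using * by (auto simp: mdeg_def lookup_add fun_eq_iff)
    then show "\<delta> \<in> ?lk ` L" using *(1) unfolding L_def by blast
  next
    fix \<delta> assume "\<delta> \<in> ?lk ` L"
    then obtain \<alpha> \<gamma> where "\<alpha> \<in> A" "mdeg \<gamma> = l" "\<delta> = ?lk (\<alpha> + \<gamma>)" by (auto simp: L_def)
    then have "\<delta> = (\<lambda>i. ?lk \<alpha> i + ?lk \<gamma> i)" "sum (?lk \<gamma>) UNIV = l" "?lk \<alpha> \<in> ?lk ` A"
      by (auto simp: mdeg_def lookup_add fun_eq_iff)
    then show "\<delta> \<in> {\<lambda>i. \<alpha> i + \<gamma> i | \<alpha> \<gamma>. \<alpha> \<in> ?lk ` A \<and> sum \<gamma> UNIV = l}"
      by blast
  qed
  also have "card (?lk ` L) = card L" by (rule card_image[OF inj])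
  also have "card L \<le> card T"
  proof (rule card_leading_le[OF T(1)])
    show "finite L" using L finite_mdeg finite_subset by blast
    show "inj_on (weight v) L" using v L by (auto intro: inj_on_subset)
    fix \<delta> assume "\<delta> \<in> L"
    then obtain \<alpha> \<gamma> f where "\<delta> = \<alpha> + \<gamma>" "mdeg \<gamma> = l" "f \<in> cfun.span U" "leading (weight v) f \<alpha>"
      by (auto simp: L_def A_def)
    then show "\<exists>f\<in>cfun.span T. leading (weight v) f \<delta>"
      using shift_in_span[of f U \<gamma> T] T(2) leading_shift by blast
  qed
  finally show ?thesis .
qed

section \<open>The rank bound\<close>

lemma orthonormal_independent:
  fixes u :: "'k \<Rightarrow> 'a \<Rightarrow> complex"
  assumes "finite K" "\<And>k l. k \<in> K \<Longrightarrow> l \<in> K \<Longrightarrow> (\<Sum>\<alpha>\<in>D. u k \<alpha> * cnj (u l \<alpha>)) = (if k = l then 1 else 0)"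
  shows "inj_on u K" "cfun.independent (u ` K)"
proof -
  show inj: "inj_on u K"
  proof (rule inj_onI, rule ccontr)
    fix k l assume "k \<in> K" "l \<in> K" "u k = u l" "k \<noteq> l"
    then show False using assms(2)[of k l] assms(2)[of k k] by simp
  qed
  show "cfun.independent (u ` K)"
  proof (rule cfun.independent_if_scalars_zero)
    fix c f assume zero: "(\<Sum>f\<in>u ` K. (\<lambda>x. c f * f x)) = 0" and "f \<in> u ` K"
    then obtain k where k: "k \<in> K" "f = u k" by auto
    have "(\<Sum>l\<in>K. c (u l) * u l \<alpha>) = 0" for \<alpha>
      using fun_cong[OF zero, of \<alpha>] by (simp add: sum_fun_apply sum.reindex[OF inj])
    then have "0 = (\<Sum>\<alpha>\<in>D. (\<Sum>l\<in>K. c (u l) * u l \<alpha>) * cnj (u k \<alpha>))" by simp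
    also have "\<dots> = (\<Sum>l\<in>K. c (u l) * (\<Sum>\<alpha>\<in>D. u l \<alpha> * cnj (u k \<alpha>)))"
      unfolding sum_distrib_right sum_distrib_left by (subst sum.swap) (simp add: mult.assoc)
    also have "\<dots> = (\<Sum>l\<in>K. if l = k then c (u k) else 0)"
      using assms(2) k(1) by (intro sum.cong) auto
    finally show "c f = 0" using assms(1) k by simp
  qed (use assms(1) in auto)
qed

theorem theorem4p2:
  fixes M :: "'n::finite bipoly" and l d p q r :: nat
  assumes "CARD('n) \<ge> 2" and "l \<ge> 1"
    and "M \<noteq> 0"
    and "bihomogeneous d M"
    and "hermitian_poly M"
    and "poly_signature d M = (p, q)"
    and "r = p + q"
    and "sum_of_squared_norms (\<lambda>z. bi_eval M z * complex_of_real (norm z ^ (2 * l)))"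
  shows "real p \<ge> real (macaulay_shift r (CARD('n) - 1) 0 (int l))
                    / real ((CARD('n) - 1 + l) choose l) \<and>
         (l = 1 \<longrightarrow> real p \<ge> real (macaulay_shift r (CARD('n) - 1) 0 1) / real CARD('n))"
proof -
  let ?D = "\<lambda>d. {\<alpha> :: 'n \<Rightarrow>\<^sub>0 nat. mdeg \<alpha> = d}"
  obtain u :: "nat \<Rightarrow> ('n \<Rightarrow>\<^sub>0 nat) \<Rightarrow> complex" and \<mu> :: "nat \<Rightarrow> real" and m :: nat where
    deg: "\<And>k \<alpha>. mdeg \<alpha> \<noteq> d \<Longrightarrow> u k \<alpha> = 0" and
    M: "\<And>\<alpha> \<beta>. Poly_Mapping.lookup M (\<alpha>, \<beta>) = (\<Sum>k<m. complex_of_real (\<mu> k) * u k \<alpha> * cnj (u k \<beta>))" and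
    orth: "\<And>k l. k < m \<Longrightarrow> l < m \<Longrightarrow> (\<Sum>\<alpha>\<in>?D d. u k \<alpha> * cnj (u l \<alpha>)) = (if k = l then 1 else 0)" and
    sig: "poly_signature d M = (card {k. k < m \<and> \<mu> k > 0}, card {k. k < m \<and> \<mu> k < 0})"
  proof (rule hermitian_poly_diagonalization[OF assms(4,5)], goal_cases)
    case (1 u \<mu> m)
    show ?case by (rule 1(1)) (fact 1)+
  qed
  define Kp where "Kp = {k. k < m \<and> \<mu> k > 0}"
  define Kn where "Kn = {k. k < m \<and> \<mu> k < 0}"
  have p: "p = card Kp" "q = card Kn" using sig assms(6) by (auto simp: Kp_def Kn_def)
  have K: "finite Kp" "finite Kn" "Kp \<inter> Kn = {}" by (auto simp: Kp_def Kn_def)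
  have orth': "(\<Sum>\<alpha>\<in>?D d. u k \<alpha> * cnj (u l \<alpha>)) = (if k = l then 1 else 0)"
    if "k \<in> Kp \<union> Kn" "l \<in> Kp \<union> Kn" for k l
    using that by (intro orth) (auto simp: Kp_def Kn_def)
  have U: "inj_on u (Kp \<union> Kn)" "cfun.independent (u ` (Kp \<union> Kn))"
    by (rule orthonormal_independent[of _ u "?D d", OF finite_UnI[OF K(1,2)] orth'], assumption+)+
  have cardU: "card (u ` (Kp \<union> Kn)) = r"
    unfolding card_image[OF U(1)] using K p assms(7) by (simp add: card_Un_disjoint)
  \<comment> \<open>Without a nonzero eigenvalue \<open>M\<close> would vanish; positivity of
    \<open>r\<close> is what provides a Macaulay representation.\<close>
  have "r > 0"
  proof (rule ccontr)
    assume "\<not> r > 0"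
    then have "Kp = {}" "Kn = {}" using p assms(7) K by auto
    then have "\<not> 0 < \<mu> k" "\<not> \<mu> k < 0" if "k < m" for k
      using that by (auto simp: Kp_def Kn_def)
    then have "\<mu> k = 0" if "k < m" for k
      using that by (meson linorder_less_linear)
    then have "Poly_Mapping.lookup M (\<alpha>, \<beta>) = 0" for \<alpha> \<beta> by (simp add: M)
    then have "M = 0" by (intro poly_mapping_eqI) (simp add: split_paired_all)
    then show False using assms(3) by simp
  qed

  obtain R and h :: "nat \<Rightarrow> 'n holpoly" where h: "\<And>z. bi_eval M z * complex_of_real (norm z ^ (2 * l)) =
    complex_of_real (\<Sum>i<R. (cmod (hol_eval (h i) z))\<^sup>2)"
    using assms(8) unfolding sum_of_squared_norms_def by blast
  obtain c where c: "\<And>\<gamma> :: 'n \<Rightarrow>\<^sub>0 nat. mdeg \<gamma> = l \<Longrightarrow> c \<gamma> > 0"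
    "\<And>z :: complex ^ 'n. norm z ^ (2 * l) = (\<Sum>\<gamma>\<in>?D l. c \<gamma> * (cmod (mono_val z \<gamma>))\<^sup>2)"
    using norm_power_expansion[of l] by blast
  \<comment> \<open>The \<open>h i\<close> are arbitrary polynomials, so their monomials join those
    of degree \<open>d + l\<close> to make \<open>S\<close> support both sides.\<close>
  define S where "S = ?D (d + l) \<union> (\<Union>i<R. Poly_Mapping.keys (h i))"
  have S: "finite S" unfolding S_def
    by (intro finite_UnI finite_mdeg finite_UN_I finite_lessThan finite_keys)
  define X where "X = {..<m} \<times> ?D l"
  have X: "finite X" unfolding X_def by (intro finite_cartesian_product finite_mdeg finite_lessThan)
  define g where "g x = shift (snd x) (u (fst x))" for x
  \<comment> \<open>On \<open>X\<close> the sign is that of the eigenvalue, since \<open>c\<close>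
    is positive in degree \<open>l\<close>.\<close>
  define \<nu> where "\<nu> x = \<mu> (fst x) * c (snd x)" for x
  have sum_g: "(\<Sum>\<alpha>\<in>S. g (k, \<gamma>) \<alpha> * mono_val z \<alpha>) = mono_val z \<gamma> * (\<Sum>\<beta>\<in>?D d. u k \<beta> * mono_val z \<beta>)"
    if "mdeg \<gamma> = l" for k \<gamma> z
  proof -
    have "(\<Sum>\<alpha>\<in>S. g (k, \<gamma>) \<alpha> * mono_val z \<alpha>) = (\<Sum>\<beta>\<in>?D d. u k \<beta> * mono_val z (\<beta> + \<gamma>))"
      unfolding g_def fst_conv snd_conv using that deg
      by (intro sum_shift[OF S]) (auto simp: S_def mdeg_add)
    then show ?thesis by (simp add: mono_val_add sum_distrib_left mult_ac)
  qed
  have eq: "(\<Sum>x\<in>X. \<nu> x * (cmod (\<Sum>\<alpha>\<in>S. g x \<alpha> * mono_val z \<alpha>))\<^sup>2) =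
    (\<Sum>i<R. (cmod (\<Sum>\<alpha>\<in>S. Poly_Mapping.lookup (h i) \<alpha> * mono_val z \<alpha>))\<^sup>2)" for z
  proof -
    let ?f = "\<lambda>k. \<Sum>\<beta>\<in>?D d. u k \<beta> * mono_val z \<beta>"
    have "(\<Sum>x\<in>X. \<nu> x * (cmod (\<Sum>\<alpha>\<in>S. g x \<alpha> * mono_val z \<alpha>))\<^sup>2) =
      (\<Sum>k<m. \<Sum>\<gamma>\<in>?D l. \<nu> (k, \<gamma>) * (cmod (\<Sum>\<alpha>\<in>S. g (k, \<gamma>) \<alpha> * mono_val z \<alpha>))\<^sup>2)"
      unfolding X_def by (simp only: sum.cartesian_product case_prod_unfold prod.collapse)
    also have "\<dots> = (\<Sum>k<m. \<Sum>\<gamma>\<in>?D l. \<mu> k * (cmod (?f k))\<^sup>2 * (c \<gamma> * (cmod (mono_val z \<gamma>))\<^sup>2))"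
      by (intro sum.cong refl) (simp add: sum_g \<nu>_def norm_mult power_mult_distrib)
    also have "\<dots> = (\<Sum>k<m. \<mu> k * (cmod (?f k))\<^sup>2) * norm z ^ (2 * l)"
      by (simp only: c(2) sum_product)
    also have "complex_of_real \<dots> = bi_eval M z * complex_of_real (norm z ^ (2 * l))"
      unfolding of_real_mult gram_form[symmetric] bi_eval_homogeneous[OF assms(4)] M ..
    finally have "(\<Sum>x\<in>X. \<nu> x * (cmod (\<Sum>\<alpha>\<in>S. g x \<alpha> * mono_val z \<alpha>))\<^sup>2) = (\<Sum>i<R. (cmod (hol_eval (h i) z))\<^sup>2)"
      unfolding h of_real_eq_iff .
    also have "\<dots> = (\<Sum>i<R. (cmod (\<Sum>\<alpha>\<in>S. Poly_Mapping.lookup (h i) \<alpha> * mono_val z \<alpha>))\<^sup>2)"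
    proof (rule sum.cong[OF refl])
      fix i assume "i \<in> {..<R}"
      then have "Poly_Mapping.keys (h i) \<subseteq> S" unfolding S_def by blast
      then have "hol_eval (h i) z = (\<Sum>\<alpha>\<in>S. Poly_Mapping.lookup (h i) \<alpha> * mono_val z \<alpha>)"
        unfolding hol_eval_def by (intro sum.mono_neutral_left[OF S]) (simp_all add: in_keys_iff)
      then show "(cmod (hol_eval (h i) z))\<^sup>2 = (cmod (\<Sum>\<alpha>\<in>S. Poly_Mapping.lookup (h i) \<alpha> * mono_val z \<alpha>))\<^sup>2"
        by simp
    qed
    finally show ?thesis .
  qed

  \<comment> \<open>At most \<open>p\<close> times the number of monomials of degree
    \<open>l\<close> many elements: this count is the origin of the denominator in the
    bound.\<close>
  define T where "T = g ` (Kp \<times> ?D l)"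
  have T: "finite T" unfolding T_def
    using K(1) by (intro finite_imageI finite_cartesian_product finite_mdeg)
  have supp: "g (k, \<gamma>) \<alpha> = 0" if "mdeg \<gamma> = l" "\<alpha> \<notin> S" for k \<gamma> \<alpha>
  proof (rule ccontr)
    assume "g (k, \<gamma>) \<alpha> \<noteq> 0"
    then have "shift \<gamma> (u k) \<alpha> \<noteq> 0" by (simp add: g_def)
    then obtain \<beta> where "\<alpha> = \<beta> + \<gamma>" "u k \<beta> \<noteq> 0" by (rule shift_nonzero)
    then have "mdeg \<alpha> = d + l" using deg[of \<beta> k] that(1) by (auto simp: mdeg_add)
    then show False using that(2) by (simp add: S_def)
  qed
  have span: "g (k, \<gamma>) \<in> cfun.span T" if "k \<in> Kp \<union> Kn" "mdeg \<gamma> = l" for k \<gamma>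
  proof (cases "k \<in> Kp")
    case True
    then show ?thesis using that by (intro cfun.span_base) (auto simp: T_def)
  next
    case False
    then have k: "k < m" "\<mu> k < 0" using that by (auto simp: Kn_def)
    show ?thesis
    proof (rule in_span_by_functionals[OF S])
      show "g (k, \<gamma>) \<alpha> = 0" if "\<alpha> \<notin> S" for \<alpha> using supp[OF \<open>mdeg \<gamma> = l\<close> that] .
      show "t \<alpha> = 0" if "t \<in> T" "\<alpha> \<notin> S" for t \<alpha> using that supp by (auto simp: T_def)
      fix \<phi> assume "\<And>t. t \<in> T \<Longrightarrow> (\<Sum>\<alpha>\<in>S. \<phi> \<alpha> * t \<alpha>) = 0"
      then have ann: "(\<Sum>\<alpha>\<in>S. g x \<alpha> * \<phi> \<alpha>) = 0" if "x \<in> Kp \<times> ?D l" for x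
        using that unfolding T_def by (metis (no_types, lifting) image_eqI mult.commute sum.cong)
      have "(\<Sum>\<alpha>\<in>S. g (k, \<gamma>) \<alpha> * \<phi> \<alpha>) = 0"
      proof (rule sum_of_squares_annihilator[OF S X eq])
        fix x assume x: "x \<in> X" "\<nu> x > 0"
        then have "c (snd x) > 0" using c(1) by (auto simp: X_def)
        then have "\<mu> (fst x) > 0" using x(2) by (simp add: \<nu>_def zero_less_mult_iff)
        then show "(\<Sum>\<alpha>\<in>S. g x \<alpha> * \<phi> \<alpha>) = 0"
          using x(1) by (intro ann) (auto simp: X_def Kp_def)
      next
        show "(k, \<gamma>) \<in> X" using k that by (simp add: X_def)
        show "\<nu> (k, \<gamma>) < 0" using k c(1)[OF that(2)] by (simp add: \<nu>_def mult_neg_pos)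
      qed
      then show "(\<Sum>\<alpha>\<in>S. \<phi> \<alpha> * g (k, \<gamma>) \<alpha>) = 0" by (simp add: mult.commute)
    qed
  qed

  have "macaulay_shift r (CARD('n) - 1) 0 (int l) = (growth (CARD('n) - 1) ^^ l) (card (u ` (Kp \<union> Kn)))"
    unfolding cardU using \<open>r > 0\<close> assms(1) by (intro macaulay_shift_eq_growth) auto
  also have "\<dots> \<le> card T"
  proof (rule iterated_growth_card_le[OF U(2) _ T])
    show "f \<alpha> = 0" if "f \<in> u ` (Kp \<union> Kn)" "mdeg \<alpha> \<noteq> d" for f \<alpha> using that deg by auto
    show "shift \<gamma> f \<in> cfun.span T" if "f \<in> u ` (Kp \<union> Kn)" "mdeg \<gamma> = l" for f \<gamma>
      using that span by (auto simp: g_def)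
  qed
  also have "card T \<le> card (Kp \<times> ?D l)"
    unfolding T_def using K(1) by (intro card_image_le finite_cartesian_product finite_mdeg)
  also have "\<dots> \<le> p * ((CARD('n) - 1 + l) choose l)"
    unfolding card_cartesian_product p by (intro mult_le_mono card_mdeg_le order_refl)
  finally have "real (macaulay_shift r (CARD('n) - 1) 0 (int l)) \<le> real p * real ((CARD('n) - 1 + l) choose l)"
    unfolding of_nat_mult[symmetric] of_nat_le_iff .
  then have bound: "real p \<ge> real (macaulay_shift r (CARD('n) - 1) 0 (int l)) / real ((CARD('n) - 1 + l) choose l)"
    by (simp add: divide_le_eq zero_less_binomial)
  show ?thesis
  proof (intro conjI impI bound)
    assume "l = 1"
    then show "real p \<ge> real (macaulay_shift r (CARD('n) - 1) 0 1) / real CARD('n)"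
      using bound assms(1) by simp
  qed
qed

end
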